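(* Let $G$ be a Cayley automatic group and let $H$ be any virtually infinite cyclic group. Then the restricted wreath product $G \wr H$ is Cayley automatic.
   Context: **Regular languages and relations.** An alphabet is a finite set $\Lambda$; $\Lambda^*$ denotes the set of all finite words over $\Lambda$ (including the empty word). A language $L \subseteq \Lambda^*$ is regular if it is accepted by a finite state automaton. A binary relation $R \subseteq \Lambda^* \times \Lambda^*$ is regular if it is recognised by a two-tape synchronous automaton, i.e. a finite automaton that reads both words simultaneously, one letter from each tape per step, the shorter word being padded at its end with a padding symbol $\diamond \notin \Lambda$. Equivalently, the set of convolutions $u \otimes v$ of the pairs $(u,v) \in R$ is a regular language over the alphabet $(\Lambda \cup \{\diamond\})^2 \setminus \{(\diamond,\diamond)\}$. **Cayley automatic groups.** A Cayley automatic structure for a group $G$ is a 4-tuple $(S,\Lambda,L,\psi)$ where (1) $S$ is a finite symmetric generating set for $G$ (that is, $S = S^{-1}$); (2) $\Lambda$ is an alphabet and $L \subseteq \Lambda^*$ is a regular language; (3) $\psi \colon L \to G$ is a bijection; (4) for each $a \in S$ the binary relation $$R_a = \{(u,v) \in L \times L \mid \psi(u)a =_G \psi(v)\} \subseteq \Lambda^* \times \Lambda^*$$ is regular, i.e. recognised by a two-tape synchronous automaton. A group is called Cayley automatic if it has a Cayley automatic structure $(S,\Lambda,L,\psi)$ with respect to some finite generating set $S$. **Virtually infinite cyclic.** A group $H$ is virtually infinite cyclic if it has a finite-index subgroup isomorphic to $\mathbb{Z}$. **Restricted wreath product.** For groups $G$ and $H$, let $G^{(H)}$ be the set of all functions $\gamma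 \colon H \to G$ with finite support, i.e. with $\gamma(h) \neq 1_G$ for at most finitely many $h \in H$; functions are multiplied pointwise. For $\gamma \in G^{(H)}$ and $h \in H$, let $\gamma^h \in G^{(H)}$ be given by $\gamma^h(x) = \gamma(hx)$ for all $x \in H$. The restricted wreath product $G \wr H$ is the set $G^{(H)} \times H$ with multiplication $$(\gamma,h)\cdot(\gamma',h') = \left(\gamma\,(\gamma')^{h^{-1}},\, hh'\right).$$ *)

theory Defs
  imports "HOL-Algebra.Algebra"
begin

record ('s, 'l) fsa =
  states :: "'s set"
  init :: 's
  accepting :: "'s set"
  step :: "'s \<Rightarrow> 'l \<Rightarrow> 's"

text \<open>Automata are deterministic and complete over the alphabet \<open>\<Lambda>\<close>.\<close>

definition fsa_over :: "'l set \<Rightarrow> ('s, 'l) fsa \<Rightarrow> bool" where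
  "fsa_over \<Lambda> M \<longleftrightarrow>
     finite (states M) \<and> init M \<in> states M \<and> accepting M \<subseteq> states M \<and>
     (\<forall>q\<in>states M. \<forall>a\<in>\<Lambda>. step M q a \<in> states M)"

definition fsa_language :: "'l set \<Rightarrow> ('s, 'l) fsa \<Rightarrow> 'l list set" where
  "fsa_language \<Lambda> M = {w \<in> lists \<Lambda>. foldl (step M) (init M) w \<in> accepting M}"

text \<open>States are natural numbers, which is no restriction as the state set is finite.\<close>

definition regular_language :: "'l set \<Rightarrow> 'l list set \<Rightarrow> bool" where
  "regular_language \<Lambda> L \<longleftrightarrow>
     finite \<Lambda> \<and> (\<exists>M :: (nat, 'l) fsa. fsa_over \<Lambda> M \<and> L = fsa_language \<Lambda> M)"

text \<open>The padding symbol is \<open>None\<close>; a letter \<open>a\<close> of the original alphabet becomes \<open>Some a\<close>.\<close>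

definition padded_alphabet :: "'l set \<Rightarrow> ('l option \<times> 'l option) set" where
  "padded_alphabet \<Lambda> =
     insert None (Some ` \<Lambda>) \<times> insert None (Some ` \<Lambda>) - {(None, None)}"

fun convolution :: "'l list \<Rightarrow> 'l list \<Rightarrow> ('l option \<times> 'l option) list" where
  "convolution [] [] = []"
| "convolution (a # u) [] = (Some a, None) # convolution u []"
| "convolution [] (b # v) = (None, Some b) # convolution [] v"
| "convolution (a # u) (b # v) = (Some a, Some b) # convolution u v"

definition regular_relation :: "'l set \<Rightarrow> ('l list \<times> 'l list) set \<Rightarrow> bool" where
  "regular_relation \<Lambda> R \<longleftrightarrow>
     R \<subseteq> lists \<Lambda> \<times> lists \<Lambda> \<and>
     regular_language (padded_alphabet \<Lambda>) {convolution u v | u v. (u, v) \<in> R}"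

definition cayley_automatic_structure ::
    "('a, 'm) monoid_scheme \<Rightarrow> 'a set \<Rightarrow> 'l set \<Rightarrow> 'l list set \<Rightarrow> ('l list \<Rightarrow> 'a) \<Rightarrow> bool" where
  "cayley_automatic_structure G S \<Lambda> L \<psi> \<longleftrightarrow>
     finite S \<and> S \<subseteq> carrier G \<and> m_inv G ` S = S \<and> generate G S = carrier G \<and>
     regular_language \<Lambda> L \<and>
     bij_betw \<psi> L (carrier G) \<and>
     (\<forall>a\<in>S. regular_relation \<Lambda> {(u, v). u \<in> L \<and> v \<in> L \<and> \<psi> u \<otimes>\<^bsub>G\<^esub> a = \<psi> v})"

text \<open>Taking the letters to be natural numbers is no restriction, since alphabets are finite
  and letters can be renamed.\<close>

definition cayley_automatic :: "('a, 'm) monoid_scheme \<Rightarrow> bool" where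
  "cayley_automatic G \<longleftrightarrow>
     group G \<and> (\<exists>S (\<Lambda> :: nat set) L \<psi>. cayley_automatic_structure G S \<Lambda> L \<psi>)"

definition virtually_infinite_cyclic :: "('a, 'm) monoid_scheme \<Rightarrow> bool" where
  "virtually_infinite_cyclic H \<longleftrightarrow>
     group H \<and>
     (\<exists>K. subgroup K H \<and> finite (rcosets\<^bsub>H\<^esub> K) \<and> H\<lparr>carrier := K\<rparr> \<cong> integer_group)"

text \<open>Functions on \<open>carrier H\<close> are represented extensionally, i.e. with the value
  \<open>undefined\<close> outside \<open>carrier H\<close>.\<close>

definition fin_supp_group ::
    "('a, 'm) monoid_scheme \<Rightarrow> ('b, 'n) monoid_scheme \<Rightarrow> ('b \<Rightarrow> 'a) monoid" where
  "fin_supp_group G H = sum_group (carrier H) (\<lambda>_. G)"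

definition shift :: "('b, 'n) monoid_scheme \<Rightarrow> 'b \<Rightarrow> ('b \<Rightarrow> 'a) \<Rightarrow> ('b \<Rightarrow> 'a)" where
  "shift H h \<gamma> = (\<lambda>x\<in>carrier H. \<gamma> (h \<otimes>\<^bsub>H\<^esub> x))"

definition restricted_wreath ::
    "('a, 'm) monoid_scheme \<Rightarrow> ('b, 'n) monoid_scheme \<Rightarrow> (('b \<Rightarrow> 'a) \<times> 'b) monoid" where
  "restricted_wreath G H =
     \<lparr>carrier = carrier (fin_supp_group G H) \<times> carrier H,
      monoid.mult = (\<lambda>(\<gamma>, h) (\<gamma>', h').
        (\<gamma> \<otimes>\<^bsub>fin_supp_group G H\<^esub> shift H (inv\<^bsub>H\<^esub> h) \<gamma>', h \<otimes>\<^bsub>H\<^esub> h')),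
      one = (\<one>\<^bsub>fin_supp_group G H\<^esub>, \<one>\<^bsub>H\<^esub>)\<rparr>"

lemma carrier_fin_supp_group:
  assumes "group G"
  shows "carrier (fin_supp_group G H) =
    {\<gamma> \<in> carrier H \<rightarrow>\<^sub>E carrier G. finite {h \<in> carrier H. \<gamma> h \<noteq> \<one>\<^bsub>G\<^esub>}}"
  by (simp add: fin_supp_group_def carrier_sum_group assms)

lemma shift_closed:
  assumes "group G" "group H" "h \<in> carrier H" "\<gamma> \<in> carrier (fin_supp_group G H)"
  shows "shift H h \<gamma> \<in> carrier (fin_supp_group G H)"
proof -
  interpret H: group H by fact
  let ?A = "{x \<in> carrier H. \<gamma> x \<noteq> \<one>\<^bsub>G\<^esub>}"
  have "{x \<in> carrier H. shift H h \<gamma> x \<noteq> \<one>\<^bsub>G\<^esub>} \<subseteq> (\<lambda>y. inv\<^bsub>H\<^esub> h \<otimes>\<^bsub>H\<^esub> y) ` ?A"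
  proof
    fix x assume x: "x \<in> {x \<in> carrier H. shift H h \<gamma> x \<noteq> \<one>\<^bsub>G\<^esub>}"
    then have "h \<otimes>\<^bsub>H\<^esub> x \<in> ?A" "x = inv\<^bsub>H\<^esub> h \<otimes>\<^bsub>H\<^esub> (h \<otimes>\<^bsub>H\<^esub> x)"
      using assms(3) by (auto simp: shift_def H.m_assoc[symmetric])
    then show "x \<in> (\<lambda>y. inv\<^bsub>H\<^esub> h \<otimes>\<^bsub>H\<^esub> y) ` ?A" by blast
  qed
  moreover have "finite ?A" using assms by (simp add: carrier_fin_supp_group)
  ultimately have "finite {x \<in> carrier H. shift H h \<gamma> x \<noteq> \<one>\<^bsub>G\<^esub>}"
    using finite_surj by blast
  moreover have "shift H h \<gamma> \<in> carrier H \<rightarrow>\<^sub>E carrier G"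
    using assms by (auto simp: carrier_fin_supp_group shift_def)
  ultimately show ?thesis using assms by (simp add: carrier_fin_supp_group)
qed

lemma group_restricted_wreath:
  assumes "group G" "group H"
  shows "group (restricted_wreath G H)"
proof -
  interpret G: group G by fact
  interpret H: group H by fact
  let ?F = "fin_supp_group G H"
  interpret F: group ?F using assms by (simp add: fin_supp_group_def)
  have multF: "\<And>f g. f \<otimes>\<^bsub>?F\<^esub> g = (\<lambda>x\<in>carrier H. f x \<otimes>\<^bsub>G\<^esub> g x)"
    and oneF: "\<one>\<^bsub>?F\<^esub> = (\<lambda>x\<in>carrier H. \<one>\<^bsub>G\<^esub>)"
    by (simp_all add: fin_supp_group_def)
  have shift_mult: "shift H h (f \<otimes>\<^bsub>?F\<^esub> g) = shift H h f \<otimes>\<^bsub>?F\<^esub> shift H h g"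
    if "h \<in> carrier H" for h f g
    using that by (auto simp: shift_def multF)
  have shift_shift: "shift H h (shift H k f) = shift H (k \<otimes>\<^bsub>H\<^esub> h) f"
    if "h \<in> carrier H" "k \<in> carrier H" for h k f
    using that by (auto simp: shift_def H.m_assoc)
  have shift_one: "shift H \<one>\<^bsub>H\<^esub> f = f" if "f \<in> carrier ?F" for f
  proof -
    have "f \<in> extensional (carrier H)"
      using that assms by (auto simp: carrier_fin_supp_group PiE_def)
    then show ?thesis by (auto simp: shift_def restrict_def extensional_def)
  qed
  have shift_id: "shift H h \<one>\<^bsub>?F\<^esub> = \<one>\<^bsub>?F\<^esub>" if "h \<in> carrier H" for h
    using that by (auto simp: shift_def oneF)
  have closed: "\<And>h f. h \<in> carrier H \<Longrightarrow> f \<in> carrier ?F \<Longrightarrow> shift H h f \<in> carrier ?F"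
    by (rule shift_closed[OF assms])
  let ?W = "restricted_wreath G H"
  have carrier: "carrier ?W = carrier ?F \<times> carrier H"
    and mult: "\<And>f h g k. (f, h) \<otimes>\<^bsub>?W\<^esub> (g, k) =
      (f \<otimes>\<^bsub>?F\<^esub> shift H (inv\<^bsub>H\<^esub> h) g, h \<otimes>\<^bsub>H\<^esub> k)"
    and one: "\<one>\<^bsub>?W\<^esub> = (\<one>\<^bsub>?F\<^esub>, \<one>\<^bsub>H\<^esub>)"
    by (simp_all add: restricted_wreath_def)
  show ?thesis
  proof (rule groupI)
    fix p q assume "p \<in> carrier ?W" "q \<in> carrier ?W"
    then show "p \<otimes>\<^bsub>?W\<^esub> q \<in> carrier ?W"
      by (cases p, cases q) (simp add: carrier mult closed)
  next
    show "\<one>\<^bsub>?W\<^esub> \<in> carrier ?W"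
      by (simp add: carrier one)
  next
    fix p q r assume "p \<in> carrier ?W" "q \<in> carrier ?W" "r \<in> carrier ?W"
    then show "p \<otimes>\<^bsub>?W\<^esub> q \<otimes>\<^bsub>?W\<^esub> r = p \<otimes>\<^bsub>?W\<^esub> (q \<otimes>\<^bsub>?W\<^esub> r)"
      by (cases p, cases q, cases r)
        (simp add: carrier mult closed shift_mult shift_shift F.m_assoc H.m_assoc H.inv_mult_group)
  next
    fix p assume "p \<in> carrier ?W"
    then show "\<one>\<^bsub>?W\<^esub> \<otimes>\<^bsub>?W\<^esub> p = p"
      by (cases p) (simp add: carrier mult one shift_one)
  next
    fix p assume "p \<in> carrier ?W"
    then obtain f h where p: "p = (f, h)" "f \<in> carrier ?F" "h \<in> carrier H"
      by (auto simp: carrier)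
    let ?q = "(shift H h (inv\<^bsub>?F\<^esub> f), inv\<^bsub>H\<^esub> h)"
    have "shift H h (inv\<^bsub>?F\<^esub> f) \<otimes>\<^bsub>?F\<^esub> shift H h f = shift H h (inv\<^bsub>?F\<^esub> f \<otimes>\<^bsub>?F\<^esub> f)"
      by (rule shift_mult[OF p(3), symmetric])
    also have "\<dots> = \<one>\<^bsub>?F\<^esub>"
      using p by (simp add: shift_id)
    finally have "?q \<otimes>\<^bsub>?W\<^esub> p = \<one>\<^bsub>?W\<^esub>"
      using p by (simp add: mult one)
    moreover have "?q \<in> carrier ?W"
      using p by (simp add: carrier closed)
    ultimately show "\<exists>q\<in>carrier ?W. q \<otimes>\<^bsub>?W\<^esub> p = \<one>\<^bsub>?W\<^esub>"
      by blast
  qed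
qed

end

theory Submission
  imports Defs
begin

text \<open>
  An element of the wreath product is a lamplighter standing at a point of \<open>H\<close>, with a lamp at every
  point whose state is an element of \<open>G\<close>; almost all lamps are in the state \<open>1\<close>. Right
  multiplication by a generator either changes the lamp at the lamplighter by a generator of \<open>G\<close>
  (\<open>mult_lamp\<close>) or moves the lamplighter along a generator of \<open>H\<close> (\<open>mult_walk\<close>).

  A virtually infinite cyclic group has the form \<open>H = {\<zeta> n \<cdot> r j | n \<in> \<int>, j < d}\<close>, where the
  \<open>\<zeta> n\<close> form an infinite cyclic subgroup. Right multiplication by a fixed element changes \<open>n\<close> by an
  amount that depends on \<open>j\<close> only. Folding the integers at \<open>0\<close> therefore enumerates \<open>H\<close> by the natural
  numbers in such a way that right multiplication by \<open>t\<close> becomes a map \<open>\<sigma>\<close> on indices with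
  \<open>\<sigma> (k + D) = \<sigma> k + D\<close> for large \<open>k\<close> (\<open>virtually_infinite_cyclic_enumeration\<close>). The lamps thus form
  a one-sided tape. It is written as the concatenation of the words for the states of the lamps, each
  preceded by a mark that tells whether the lamplighter stands there, and it is cut off after the last
  lamp that matters.

  The words for the lamps have unbounded length, and changing one of them may change its length, so
  that the rest of the tape is displaced. This displacement is bounded: multiplication by a generator
  is a bijection in both directions, and a regular relation that is functional in both directions
  bounds the difference of the lengths (\<open>lag_bounded_if_bijective\<close>). A synchronous automaton can
  store a bounded number of letters and so compare the displaced copies. A move of the lamplighter
  changes two marks at a bounded distance and may append or remove boundedly many trivial lamps at
  the end of the tape.

  Regularity is established without constructing automata. By the theorem of Myhill and Nerode, a
  language is regular if and only if it has finitely many left quotients. For relations the quotients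
  by pairs of words of equal length play this role, and the property of having finitely many of them
  (\<open>sync_regular\<close>) agrees with regularity for relations of bounded length difference
  (\<open>sync_regular_if_regular_relation\<close>, \<open>regular_relation_if_sync_regular\<close>). It is
  preserved by concatenation of relations (\<open>sync_regular_rconc\<close>), which is the step where the
  displacement is absorbed, and all relations on tapes are put together in this way
  (\<open>codes_regular\<close>, \<open>relight_codes_regular\<close>, \<open>move_codes_regular\<close>).
\<close>

section \<open>Finitely many quotients characterise regular languages\<close>

definition lquot :: "'l list set \<Rightarrow> 'l list \<Rightarrow> 'l list set" where
  "lquot L u = {s. u @ s \<in> L}"

lemma lquot_append: "lquot L (u @ v) = lquot (lquot L u) v"
  by (simp add: lquot_def)

lemma lquot_Nil [simp]: "lquot L [] = L"
  by (simp add: lquot_def)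

lemma finite_lquot_if_regular:
  assumes "regular_language \<Lambda> L"
  shows "finite (range (lquot L))"
proof -
  obtain M :: "(nat, 'a) fsa" where M: "fsa_over \<Lambda> M" and L: "L = fsa_language \<Lambda> M"
    using assms unfolding regular_language_def by blast
  let ?run = "foldl (step M) (init M)"
  let ?from = "\<lambda>q. {s \<in> lists \<Lambda>. foldl (step M) q s \<in> accepting M}"
  have run: "?run u \<in> states M" if "u \<in> lists \<Lambda>" for u
    using that M by (induction u rule: rev_induct) (auto simp: fsa_over_def)
  have "lquot L u \<in> insert {} (?from ` states M)" for u
  proof (cases "u \<in> lists \<Lambda>")
    case True
    then have "lquot L u = ?from (?run u)"
      by (auto simp: lquot_def L fsa_language_def)
    then show ?thesis using run[OF True] by blast
  next
    case False
    then show ?thesis by (auto simp: lquot_def L fsa_language_def)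
  qed
  then have "range (lquot L) \<subseteq> insert {} (?from ` states M)" by blast
  moreover have "finite (insert {} (?from ` states M))" using M by (simp add: fsa_over_def)
  ultimately show ?thesis by (rule finite_subset)
qed

text \<open>The quotients themselves are the states of an automaton: reading a letter takes the quotient
  by it, and a quotient accepts if it contains the empty word. An injection into the natural numbers
  turns them into states of the required type.\<close>

lemma regular_if_finite_lquot:
  assumes fin: "finite \<Lambda>" and sub: "L \<subseteq> lists \<Lambda>" and quots: "finite (range (lquot L))"
  shows "regular_language \<Lambda> L"
proof -
  let ?Q = "range (lquot L)"
  obtain f :: "'a list set \<Rightarrow> nat" where f: "inj_on f ?Q"
    using finite_imp_inj_to_nat_seg[OF quots] by blast
  let ?g = "inv_into ?Q f"
  let ?M = "\<lparr>states = f ` ?Q, init = f (lquot L []), accepting = f ` {Q \<in> ?Q. [] \<in> Q},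
    step = (\<lambda>q a. f (lquot (?g q) [a]))\<rparr> :: (nat, 'a) fsa"
  have g: "?g (f (lquot L u)) = lquot L u" for u
    using f by (simp add: inv_into_f_f)
  have over: "fsa_over \<Lambda> ?M"
    unfolding fsa_over_def using quots g by (auto simp del: lquot_Nil simp flip: lquot_append)
  have run: "foldl (step ?M) (init ?M) w = f (lquot L w)" for w
    by (induction w rule: rev_induct) (use g in \<open>simp_all add: lquot_append\<close>)
  have acc: "f (lquot L w) \<in> accepting ?M \<longleftrightarrow> w \<in> L" for w
  proof -
    have "f (lquot L w) \<in> f ` {Q \<in> ?Q. [] \<in> Q} \<longleftrightarrow> lquot L w \<in> {Q \<in> ?Q. [] \<in> Q}"
      by (rule inj_on_image_mem_iff[OF f]) auto
    then show ?thesis by (simp add: lquot_def)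
  qed
  have "L = fsa_language \<Lambda> ?M"
    unfolding fsa_language_def run acc using sub by blast
  then show ?thesis using over fin unfolding regular_language_def by blast
qed

lemma regular_language_iff_finite_lquot:
  "regular_language \<Lambda> L \<longleftrightarrow> finite \<Lambda> \<and> L \<subseteq> lists \<Lambda> \<and> finite (range (lquot L))"
  using finite_lquot_if_regular[of \<Lambda> L] regular_if_finite_lquot[of \<Lambda> L]
  by (auto simp: regular_language_def fsa_language_def)

text \<open>This replaces the subset construction: if every continuation belongs to one of finitely many
  sets of simultaneously correct continuations, each quotient is a union of such sets. The different
  members of the family correspond to the different guesses of a nondeterministic automaton.\<close>

lemma finite_lquot_if_cover:
  assumes fin: "finite \<F>"
    and cover: "\<And>u s. u @ s \<in> L \<Longrightarrow> \<exists>A\<in>\<F>. s \<in> A \<and> A \<subseteq> lquot L u"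
  shows "finite (range (lquot L))"
proof -
  have "lquot L u = \<Union>{A \<in> \<F>. A \<subseteq> lquot L u}" for u
    using cover[of u] by (fastforce simp: lquot_def)
  then have "range (lquot L) \<subseteq> Union ` Pow \<F>" by blast
  then show ?thesis by (rule finite_subset) (use fin in simp)
qed

section \<open>Synchronous quotients of relations\<close>

definition quot :: "('l list \<times> 'l list) set \<Rightarrow> 'l list \<Rightarrow> 'l list \<Rightarrow> ('l list \<times> 'l list) set" where
  "quot R u v = {(s, t). (u @ s, v @ t) \<in> R}"

text \<open>Only pairs of equal length are considered: they are what a synchronous automaton has read before
  one of the words has ended. The behaviour after that is controlled by a bound on the difference of
  the lengths.\<close>

definition sync_regular :: "'l set \<Rightarrow> ('l list \<times> 'l list) set \<Rightarrow> bool" where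
  "sync_regular \<Lambda> R \<longleftrightarrow> finite \<Lambda> \<and> R \<subseteq> lists \<Lambda> \<times> lists \<Lambda> \<and>
     finite {quot R u v | u v. length u = length v}"

lemma sync_regularI:
  "finite \<Lambda> \<Longrightarrow> R \<subseteq> lists \<Lambda> \<times> lists \<Lambda> \<Longrightarrow>
    finite {quot R u v | u v. length u = length v} \<Longrightarrow> sync_regular \<Lambda> R"
  by (simp add: sync_regular_def)

lemma sync_regularD:
  assumes "sync_regular \<Lambda> R"
  shows "finite \<Lambda>" "R \<subseteq> lists \<Lambda> \<times> lists \<Lambda>" "finite {quot R u v | u v. length u = length v}"
  using assms by (simp_all add: sync_regular_def)

definition lag_bounded :: "nat \<Rightarrow> ('l list \<times> 'l list) set \<Rightarrow> bool" where
  "lag_bounded c R \<longleftrightarrow> (\<forall>(u, v)\<in>R. length u \<le> length v + c \<and> length v \<le> length u + c)"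

lemma quot_quot: "quot (quot R u v) s t = quot R (u @ s) (v @ t)"
  by (simp add: quot_def)

lemma mem_quot [simp]: "(s, t) \<in> quot R u v \<longleftrightarrow> (u @ s, v @ t) \<in> R"
  by (simp add: quot_def)

lemma finite_quot_if_cover:
  assumes fin: "finite \<F>"
    and cover: "\<And>u v s t. length u = length v \<Longrightarrow> (u @ s, v @ t) \<in> R \<Longrightarrow>
      \<exists>A\<in>\<F>. (s, t) \<in> A \<and> A \<subseteq> quot R u v"
  shows "finite {quot R u v | u v. length u = length v}"
proof -
  have "quot R u v = \<Union>{A \<in> \<F>. A \<subseteq> quot R u v}" if len: "length u = length v" for u v
  proof (intro equalityI subrelI)
    fix s t assume "(s, t) \<in> quot R u v"
    then obtain A where "A \<in> \<F>" "(s, t) \<in> A" "A \<subseteq> quot R u v"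
      using cover[OF len, of s t] unfolding mem_quot by blast
    then show "(s, t) \<in> \<Union>{A \<in> \<F>. A \<subseteq> quot R u v}" by (intro UnionI CollectI conjI)
  qed blast
  then have "{quot R u v | u v. length u = length v} \<subseteq> Union ` Pow \<F>"
    by (intro subsetI, elim CollectE exE conjE) (erule ssubst, rule image_eqI, assumption, simp)
  then show ?thesis by (rule finite_subset) (use fin in simp)
qed

text \<open>When one word is ahead of the other by at most \<open>c\<close> letters, the surplus is one of finitely many
  words, and the quotient is a further quotient, by this surplus, of a synchronous one.\<close>

lemma finite_lagged_quot:
  assumes R: "sync_regular \<Lambda> R"
  shows "finite {quot R u v | u v. length u \<le> length v + c \<and> length v \<le> length u + c}"
    (is "finite ?lagged")
proof -
  let ?sync = "{quot R u v | u v. length u = length v}"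
  let ?W = "{w. set w \<subseteq> \<Lambda> \<and> length w \<le> c}"
  have fin: "finite \<Lambda>" "finite ?sync" and sub: "R \<subseteq> lists \<Lambda> \<times> lists \<Lambda>"
    using R by (auto simp: sync_regular_def)
  have "quot R u v \<in> insert {} ((\<lambda>(Q, s, t). quot Q s t) ` (?sync \<times> ?W \<times> ?W))"
    if lag: "length u \<le> length v + c" "length v \<le> length u + c" for u v
  proof (cases "set u \<subseteq> \<Lambda> \<and> set v \<subseteq> \<Lambda>")
    case True
    define n where "n = min (length u) (length v)"
    have "quot R u v = quot (quot R (take n u) (take n v)) (drop n u) (drop n v)"
      by (simp add: quot_quot)
    moreover have "quot R (take n u) (take n v) \<in> ?sync"
      by (intro CollectI exI[of _ "take n u"] exI[of _ "take n v"]) (simp add: n_def)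
    moreover have "drop n u \<in> ?W" "drop n v \<in> ?W"
      using True lag set_drop_subset[of n u] set_drop_subset[of n v] by (auto simp: n_def)
    ultimately show ?thesis by (intro insertI2 image_eqI[where x = "(_, _, _)"]) auto
  next
    case False
    then have "quot R u v = {}" using sub by (auto simp: quot_def)
    then show ?thesis by simp
  qed
  then have "?lagged \<subseteq> insert {} ((\<lambda>(Q, s, t). quot Q s t) ` (?sync \<times> ?W \<times> ?W))"
    by (intro subsetI, elim CollectE exE conjE) (erule ssubst, assumption)
  moreover have "finite ?W" using finite_lists_length_le[OF fin(1)] .
  then have "finite (insert {} ((\<lambda>(Q, s, t). quot Q s t) ` (?sync \<times> ?W \<times> ?W)))"
    by (intro finite.insertI finite_imageI finite_cartesian_product fin(2))
  ultimately show ?thesis by (rule finite_subset)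
qed

section \<open>Closure properties\<close>

lemma quots_binary:
  assumes "finite {quot R u v | u v. length u = length v}"
    and "finite {quot R' u v | u v. length u = length v}"
    and "\<And>u v :: 'c list. length u = length v \<Longrightarrow> quot T u v = F (quot R u v) (quot R' u v)"
  shows "finite {quot T u v | u v. length u = length v}"
proof -
  have "{quot T u v | u v. length u = length v} \<subseteq> case_prod F `
      ({quot R u v | u v. length u = length v} \<times> {quot R' u v | u v. length u = length v})"
  proof clarify
    fix u v :: "'c list" assume "length u = length v"
    then show "quot T u v \<in> case_prod F `
      ({quot R u v | u v. length u = length v} \<times> {quot R' u v | u v. length u = length v})"
      by (intro image_eqI[of _ _ "(quot R u v, quot R' u v)"]) (use assms(3) in auto)
  qed
  then show ?thesis
    by (rule finite_subset) (intro finite_imageI finite_cartesian_product assms(1,2))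
qed

lemma quots_unary:
  assumes "finite {quot R u v | u v. length u = length v}"
    and "\<And>u v. length u = length v \<Longrightarrow> quot T u v = F (quot R u v)"
  shows "finite {quot T u v | u v. length u = length v}"
  by (rule quots_binary[OF assms(1,1), of _ "\<lambda>Q _. F Q"]) (rule assms(2))

lemma sync_regular_Un:
  assumes R: "sync_regular \<Lambda> R" and R': "sync_regular \<Lambda> R'"
  shows "sync_regular \<Lambda> (R \<union> R')"
proof (rule sync_regularI)
  show "finite {quot (R \<union> R') u v | u v. length u = length v}"
    by (rule quots_binary[OF sync_regularD(3)[OF R] sync_regularD(3)[OF R'], of _ "(\<union>)"])
      (auto simp: quot_def)
  show "R \<union> R' \<subseteq> lists \<Lambda> \<times> lists \<Lambda>"
    using sync_regularD(2)[OF R] sync_regularD(2)[OF R'] by (rule Un_least)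
qed (rule sync_regularD(1)[OF R])

lemma sync_regular_empty: "finite \<Lambda> \<Longrightarrow> sync_regular \<Lambda> {}"
  by (simp add: sync_regular_def quot_def)

lemma sync_regular_UN:
  assumes "finite I" "finite \<Lambda>" "\<And>i. i \<in> I \<Longrightarrow> sync_regular \<Lambda> (R i)"
  shows "sync_regular \<Lambda> (\<Union>i\<in>I. R i)"
  using assms(1,3)
  by (induction I rule: finite_induct) (auto simp: sync_regular_empty assms(2) intro: sync_regular_Un)

lemma sync_regular_converse:
  assumes R: "sync_regular \<Lambda> R"
  shows "sync_regular \<Lambda> (R\<inverse>)"
proof (rule sync_regularI)
  have "{quot (R\<inverse>) u v | u v. length u = length v} \<subseteq>
      converse ` {quot R u v | u v. length u = length v}"
  proof clarify
    fix u v :: "'a list" assume len: "length u = length v"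
    have "quot (R\<inverse>) u v = (quot R v u)\<inverse>" by (auto simp: quot_def)
    then show "quot (R\<inverse>) u v \<in> converse ` {quot R u v | u v. length u = length v}"
      by (rule image_eqI) (use len[symmetric] in blast)
  qed
  then show "finite {quot (R\<inverse>) u v | u v. length u = length v}"
    by (rule finite_subset) (rule finite_imageI[OF sync_regularD(3)[OF R]])
  show "R\<inverse> \<subseteq> lists \<Lambda> \<times> lists \<Lambda>" using sync_regularD(2)[OF R] by auto
qed (rule sync_regularD(1)[OF R])

lemma quot_Id_on: "length u = length v \<Longrightarrow> quot (Id_on L) u v = (if u = v then Id_on (lquot L u) else {})"
  by (auto simp: quot_def lquot_def Id_on_def)

text \<open>Languages are identified with their identity relations, so that the closure properties of
  relations serve for languages as well.\<close>

lemma sync_regular_Id_on_iff: "sync_regular \<Lambda> (Id_on L) \<longleftrightarrow> regular_language \<Lambda> L"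
proof
  assume R: "sync_regular \<Lambda> (Id_on L)"
  have "range (lquot L) \<subseteq> Domain ` {quot (Id_on L) u v | u v. length u = length v}"
  proof clarify
    fix u
    have "lquot L u = Domain (quot (Id_on L) u u)" by (simp add: quot_Id_on)
    then show "lquot L u \<in> Domain ` {quot (Id_on L) u v | u v. length u = length v}" by blast
  qed
  moreover have "finite (Domain ` {quot (Id_on L) u v | u v. length u = length v})"
    using R unfolding sync_regular_def by blast
  ultimately have "finite (range (lquot L))" by (rule finite_subset)
  then show "regular_language \<Lambda> L"
    using R unfolding regular_language_iff_finite_lquot sync_regular_def by auto
next
  assume L: "regular_language \<Lambda> L"
  have "{quot (Id_on L) u v | u v. length u = length v} \<subseteq> insert {} (Id_on ` range (lquot L))"
  proof clarify
    fix u v :: "'a list"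
    assume "length u = length v" "quot (Id_on L) u v \<notin> Id_on ` range (lquot L)"
    then show "quot (Id_on L) u v = {}" by (cases "u = v") (simp_all add: quot_Id_on)
  qed
  moreover have "finite (insert {} (Id_on ` range (lquot L)))"
    using L unfolding regular_language_iff_finite_lquot by blast
  ultimately have "finite {quot (Id_on L) u v | u v. length u = length v}" by (rule finite_subset)
  then show "sync_regular \<Lambda> (Id_on L)"
    using L unfolding regular_language_iff_finite_lquot sync_regular_def by auto
qed

lemma regular_language_Diff:
  assumes "regular_language \<Lambda> L" "regular_language \<Lambda> L'"
  shows "regular_language \<Lambda> (L - L')"
proof -
  have "lquot (L - L') u = lquot L u - lquot L' u" for u by (auto simp: lquot_def)
  then have "range (lquot (L - L')) \<subseteq> (\<lambda>(A, B). A - B) ` (range (lquot L) \<times> range (lquot L'))"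
    by auto
  moreover have "finite ((\<lambda>(A, B). A - B) ` (range (lquot L) \<times> range (lquot L')))"
    using assms unfolding regular_language_iff_finite_lquot by blast
  ultimately have "finite (range (lquot (L - L')))" by (rule finite_subset)
  then show ?thesis
    using assms unfolding regular_language_iff_finite_lquot by blast
qed

lemma sync_regular_restrict:
  assumes R: "sync_regular \<Lambda> R" and L: "regular_language \<Lambda> L"
  shows "sync_regular \<Lambda> (R \<inter> L \<times> L)"
proof (rule sync_regularI)
  have "{quot (L \<times> L) u v | u v. length u = length v} \<subseteq> (\<lambda>(A, B). A \<times> B) ` (range (lquot L) \<times> range (lquot L))"
    by (auto simp: quot_def lquot_def)
  moreover have "finite ((\<lambda>(A, B). A \<times> B) ` (range (lquot L) \<times> range (lquot L)))"
    using L unfolding regular_language_iff_finite_lquot by blast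
  ultimately have fin: "finite {quot (L \<times> L) u v | u v. length u = length v}" by (rule finite_subset)
  show "finite {quot (R \<inter> L \<times> L) u v | u v. length u = length v}"
    by (rule quots_binary[OF sync_regularD(3)[OF R] fin, of _ "(\<inter>)"]) (auto simp: quot_def)
  show "R \<inter> L \<times> L \<subseteq> lists \<Lambda> \<times> lists \<Lambda>"
    using sync_regularD(2)[OF R] by (rule le_infI1)
qed (rule sync_regularD(1)[OF R])

text \<open>This removes blank lamps from the ends of tapes after they have been compared at equal length.\<close>

lemma sync_regular_drop_suffix:
  assumes R: "sync_regular \<Lambda> R"
  shows "sync_regular \<Lambda> {(u, v). (u @ a, v @ b) \<in> R}"
proof (rule sync_regularI)
  let ?R = "{(u, v). (u @ a, v @ b) \<in> R}"
  show "finite {quot ?R u v | u v. length u = length v}"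
    by (rule quots_unary[OF sync_regularD(3)[OF R], of _ "\<lambda>Q. {(s, t). (s @ a, t @ b) \<in> Q}"])
      (simp add: quot_def)
  show "?R \<subseteq> lists \<Lambda> \<times> lists \<Lambda>"
  proof clarify
    fix u v assume "(u @ a, v @ b) \<in> R"
    then have "(u @ a, v @ b) \<in> lists \<Lambda> \<times> lists \<Lambda>"
      using sync_regularD(2)[OF R] by blast
    then show "u \<in> lists \<Lambda> \<and> v \<in> lists \<Lambda>" by simp
  qed
qed (rule sync_regularD(1)[OF R])

lemma sync_regular_map:
  assumes R: "sync_regular \<Lambda> R" and g: "inj g"
  shows "sync_regular (g ` \<Lambda>) (map_prod (map g) (map g) ` R)"
proof -
  let ?h = "map_prod (map g) (map g)"
  have quots: "quot (?h ` R) u v \<in> insert {} ((`) ?h ` {quot R u v | u v. length u = length v})"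
    if len: "length u = length v" for u v
  proof (cases "quot (?h ` R) u v = {}")
    case False
    then obtain s t x y where "(x, y) \<in> R" "u @ s = map g x" "v @ t = map g y"
      by (auto simp: quot_def)
    then obtain u0 v0 where uv: "u = map g u0" "v = map g v0"
      unfolding append_eq_map_conv by blast
    have "quot (?h ` R) u v = ?h ` quot R u0 v0"
    proof (intro Set.set_eqI iffI)
      fix p assume p: "p \<in> quot (?h ` R) u v"
      obtain s t where st: "p = (s, t)" by (cases p)
      with p have "(u @ s, v @ t) \<in> ?h ` R" by simp
      then obtain x y where xy: "(x, y) \<in> R" "u @ s = map g x" "v @ t = map g y" by auto
      then obtain s0 t0 where s0: "s = map g s0" "t = map g t0" 
        unfolding append_eq_map_conv by blast
      then have "x = u0 @ s0" "y = v0 @ t0"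
        using xy(2,3) inj_mapI[OF g] by (auto simp: uv simp flip: map_append dest: injD)
      then have "(s0, t0) \<in> quot R u0 v0" using xy(1) by simp
      then show "p \<in> ?h ` quot R u0 v0" unfolding st s0 by (rule rev_image_eqI) simp
    next
      fix p assume "p \<in> ?h ` quot R u0 v0"
      then obtain s0 t0 where "(u0 @ s0, v0 @ t0) \<in> R" "p = (map g s0, map g t0)" by auto
      then show "p \<in> quot (?h ` R) u v"
        by (auto simp: uv intro!: rev_image_eqI)
    qed
    moreover have "quot R u0 v0 \<in> {quot R u v | u v. length u = length v}"
      using len uv by auto
    ultimately show ?thesis by (intro insertI2 image_eqI)
  next
    case True
    then show ?thesis by simp
  qed
  have "{quot (?h ` R) u v | u v. length u = length v} \<subseteq>
      insert {} ((`) ?h ` {quot R u v | u v. length u = length v})"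
    by (rule subsetI, elim CollectE exE conjE, erule ssubst, rule quots)
  moreover have "finite (insert {} ((`) ?h ` {quot R u v | u v. length u = length v}))"
    using sync_regularD(3)[OF R] by simp
  ultimately have "finite {quot (?h ` R) u v | u v. length u = length v}" by (rule finite_subset)
  moreover have "?h ` R \<subseteq> lists (g ` \<Lambda>) \<times> lists (g ` \<Lambda>)"
    using sync_regularD(2)[OF R] by (auto simp: lists_image)
  ultimately show ?thesis using sync_regularD(1)[OF R] by (intro sync_regularI) simp_all
qed

definition rconc :: "('l list \<times> 'l list) set \<Rightarrow> ('l list \<times> 'l list) set \<Rightarrow> ('l list \<times> 'l list) set"
    (infixr "\<frown>" 75) where
  "A \<frown> B = {(u @ s, v @ t) | u v s t. (u, v) \<in> A \<and> (s, t) \<in> B}"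

lemma rconcI: "(u, v) \<in> A \<Longrightarrow> (s, t) \<in> B \<Longrightarrow> (u @ s, v @ t) \<in> A \<frown> B"
  by (auto simp: rconc_def)

lemma lag_bounded_rconc:
  assumes "lag_bounded c A" "lag_bounded d B"
  shows "lag_bounded (c + d) (A \<frown> B)"
proof -
  have "length (u @ s) \<le> length (v @ t) + (c + d) \<and> length (v @ t) \<le> length (u @ s) + (c + d)"
    if "(u, v) \<in> A" "(s, t) \<in> B" for u v s t
    using bspec[OF assms(1)[unfolded lag_bounded_def] that(1)]
      bspec[OF assms(2)[unfolded lag_bounded_def] that(2)] by simp
  then show ?thesis unfolding lag_bounded_def rconc_def by blast
qed

lemma sync_regular_singleton:
  assumes "finite \<Lambda>" "set u \<subseteq> \<Lambda>" "set v \<subseteq> \<Lambda>"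
  shows "sync_regular \<Lambda> {(u, v)}"
proof (rule sync_regularI)
  let ?F = "{{}} \<union> (\<lambda>(m, n). {(drop m u, drop n v)}) ` ({..length u} \<times> {..length v})"
  show "finite {quot {(u, v)} s t | s t. length s = length t}"
  proof (rule finite_quot_if_cover)
    show "finite ?F" by (intro finite_UnI finite_imageI) simp_all
    fix s t s' t' assume "(s @ s', t @ t') \<in> {(u, v)}"
    then have st: "u = s @ s'" "v = t @ t'" by simp_all
    then have "{(s', t')} \<in> ?F"
      by (intro UnI2 image_eqI[of _ _ "(length s, length t)"]) simp_all
    moreover have "{(s', t')} \<subseteq> quot {(u, v)} s t" by (simp add: st)
    ultimately show "\<exists>A\<in>?F. (s', t') \<in> A \<and> A \<subseteq> quot {(u, v)} s t" by blast
  qed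
qed (use assms in auto)

text \<open>The first factor may end at different places in the two words, but these places are at most
  \<open>c\<close> letters apart. A pair of words read so far ends within the first factor on both sides, or within
  the second on both sides, or within different factors. In the second situation the two sides have
  passed the border by amounts that differ by at most \<open>c\<close>, and in the third one side has passed it by
  at most \<open>c\<close> letters, so lagged quotients describe what remains.\<close>

lemma sync_regular_rconc:
  assumes A: "sync_regular \<Lambda> A" "lag_bounded c A" and B: "sync_regular \<Lambda> B"
  shows "sync_regular \<Lambda> (A \<frown> B)"
proof (rule sync_regularI)
  define QA where "QA = {quot A u v | u v. length u \<le> length v + c \<and> length v \<le> length u + c}"
  define QB where "QB = {quot B u v | u v. length u \<le> length v + c \<and> length v \<le> length u + c}"
  have QA: "quot A u v \<in> QA" if "length u \<le> length v + c" "length v \<le> length u + c" for u v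
    using that unfolding QA_def by (intro CollectI exI[of _ u] exI[of _ v]) simp
  have QB: "quot B u v \<in> QB" if "length u \<le> length v + c" "length v \<le> length u + c" for u v
    using that unfolding QB_def by (intro CollectI exI[of _ u] exI[of _ v]) simp
  define F1 where "F1 = (\<lambda>P. P \<frown> B) ` QA"
  \<comment> \<open>The intersections say that one side of the first factor is already complete.\<close>
  define F2 where "F2 = (\<lambda>(P, Q). (P \<inter> {[]} \<times> UNIV) \<frown> Q) ` (QA \<times> QB)"
  define F3 where "F3 = (\<lambda>(P, Q). (P \<inter> UNIV \<times> {[]}) \<frown> Q) ` (QA \<times> QB)"
  have fin: "finite QA" "finite QB"
    unfolding QA_def QB_def by (rule finite_lagged_quot[OF A(1)] finite_lagged_quot[OF B])+
  show "finite {quot (A \<frown> B) u v | u v. length u = length v}"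
  proof (rule finite_quot_if_cover)
    show "finite (F1 \<union> F2 \<union> F3 \<union> QB)"
      unfolding F1_def F2_def F3_def
      by (intro finite_UnI finite_imageI finite_cartesian_product fin)
    fix u v s t assume len: "length u = length v" and uv: "(u @ s, v @ t) \<in> A \<frown> B"
    obtain a a' b b' where ab: "(a, a') \<in> A" "(b, b') \<in> B" "u @ s = a @ b" "v @ t = a' @ b'"
      using uv by (auto simp: rconc_def)
    have lag: "length a \<le> length a' + c" "length a' \<le> length a + c"
      using A(2) ab(1) by (auto simp: lag_bounded_def)
    consider (prefix) x x' where "a = u @ x" "a' = v @ x'" "s = x @ b" "t = x' @ b'"
      | (first) y x' where "u = a @ y" "a' = v @ x'" "b = y @ s" "t = x' @ b'"
      | (second) x y' where "a = u @ x" "v = a' @ y'" "s = x @ b" "b' = y' @ t"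
      | (suffix) y y' where "u = a @ y" "v = a' @ y'" "b = y @ s" "b' = y' @ t"
      using ab(3,4) unfolding append_eq_append_conv2 by metis
    then obtain C where "C \<in> F1 \<union> F2 \<union> F3 \<union> QB" "(s, t) \<in> C" "C \<subseteq> quot (A \<frown> B) u v"
    proof cases
      case prefix
      show ?thesis
      proof (rule that)
        show "quot A u v \<frown> B \<in> F1 \<union> F2 \<union> F3 \<union> QB"
          unfolding F1_def by (intro UnI1 imageI QA) (simp_all add: len)
        show "(s, t) \<in> quot A u v \<frown> B"
          using ab prefix by (auto intro!: rconcI)
        show "quot A u v \<frown> B \<subseteq> quot (A \<frown> B) u v"
        proof (rule subrelI)
          fix s t assume "(s, t) \<in> quot A u v \<frown> B"
          then obtain p q p' q' where "(u @ p, v @ q) \<in> A" "(p', q') \<in> B" "s = p @ p'" "t = q @ q'"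
            by (auto simp: rconc_def)
          then show "(s, t) \<in> quot (A \<frown> B) u v"
            using rconcI[of "u @ p" "v @ q" A p' q' B] by simp
        qed
      qed
    next
      case first
      let ?P = "quot A a v \<inter> {[]} \<times> UNIV" and ?Q = "quot B y []"
      show ?thesis
      proof (rule that)
        show "?P \<frown> ?Q \<in> F1 \<union> F2 \<union> F3 \<union> QB"
          unfolding F2_def using len lag first
          by (intro UnI1 UnI2 image_eqI[of _ _ "(quot A a v, quot B y [])"] SigmaI QA QB) simp_all
        show "(s, t) \<in> ?P \<frown> ?Q"
          using ab first rconcI[of "[]" x' ?P s b' ?Q] by simp
        show "?P \<frown> ?Q \<subseteq> quot (A \<frown> B) u v"
        proof (rule subrelI)
          fix s t assume "(s, t) \<in> ?P \<frown> ?Q"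
          then obtain q p' q' where "(a, v @ q) \<in> A" "(y @ p', q') \<in> B" "s = p'" "t = q @ q'"
            by (auto simp: rconc_def)
          then show "(s, t) \<in> quot (A \<frown> B) u v"
            using rconcI[of a "v @ q" A "y @ p'" q' B] first by simp
        qed
      qed
    next
      case second
      let ?P = "quot A u a' \<inter> UNIV \<times> {[]}" and ?Q = "quot B [] y'"
      show ?thesis
      proof (rule that)
        show "?P \<frown> ?Q \<in> F1 \<union> F2 \<union> F3 \<union> QB"
          unfolding F3_def using len lag second
          by (intro UnI1 UnI2 image_eqI[of _ _ "(quot A u a', quot B [] y')"] SigmaI QA QB) simp_all
        show "(s, t) \<in> ?P \<frown> ?Q"
          using ab second rconcI[of x "[]" ?P b t ?Q] by simp
        show "?P \<frown> ?Q \<subseteq> quot (A \<frown> B) u v"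
        proof (rule subrelI)
          fix s t assume "(s, t) \<in> ?P \<frown> ?Q"
          then obtain p p' q' where "(u @ p, a') \<in> A" "(p', y' @ q') \<in> B" "s = p @ p'" "t = q'"
            by (auto simp: rconc_def)
          then show "(s, t) \<in> quot (A \<frown> B) u v"
            using rconcI[of "u @ p" a' A p' "y' @ q'" B] second by simp
        qed
      qed
    next
      case suffix
      show ?thesis
      proof (rule that)
        show "quot B y y' \<in> F1 \<union> F2 \<union> F3 \<union> QB"
          using len lag suffix by (intro UnI2 QB) simp_all
        show "(s, t) \<in> quot B y y'" using ab suffix by simp
        show "quot B y y' \<subseteq> quot (A \<frown> B) u v"
        proof (rule subrelI)
          fix s t assume "(s, t) \<in> quot B y y'"
          then show "(s, t) \<in> quot (A \<frown> B) u v"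
            using rconcI[OF ab(1), of "y @ s" "y' @ t" B] suffix by simp
        qed
      qed
    qed
    then show "\<exists>C\<in>F1 \<union> F2 \<union> F3 \<union> QB. (s, t) \<in> C \<and> C \<subseteq> quot (A \<frown> B) u v" by blast
  qed
  show "A \<frown> B \<subseteq> lists \<Lambda> \<times> lists \<Lambda>"
    using sync_regularD(2)[OF A(1)] sync_regularD(2)[OF B] by (fastforce simp: rconc_def)
qed (rule sync_regularD(1)[OF B])

section \<open>Regular relations and synchronous quotients\<close>

lemma convolution_append:
  "length u = length v \<Longrightarrow> convolution (u @ s) (v @ t) = convolution u v @ convolution s t"
  by (induction u v rule: list_induct2) auto

lemma convolution_append_right:
  "length u \<le> length v \<Longrightarrow> convolution u (v @ t) = convolution u v @ convolution [] t"
  by (induction u v rule: convolution.induct) auto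

lemma convolution_append_left:
  "length v \<le> length u \<Longrightarrow> convolution (u @ s) v = convolution u v @ convolution s []"
  by (induction u v rule: convolution.induct) auto

lemma length_convolution: "length (convolution u v) = max (length u) (length v)"
  by (induction u v rule: convolution.induct) auto

lemma convolution_eq_iff: "convolution u v = convolution u' v' \<longleftrightarrow> u = u' \<and> v = v'"
proof
  have "u = List.map_filter fst (convolution u v) \<and> v = List.map_filter snd (convolution u v)" for u v :: "'a list"
    by (induction u v rule: convolution.induct) (auto simp: List.map_filter_simps)
  then show "convolution u v = convolution u' v' \<Longrightarrow> u = u' \<and> v = v'" by metis
qed simp

lemma convolution_in_padded:
  "set u \<subseteq> \<Lambda> \<Longrightarrow> set v \<subseteq> \<Lambda> \<Longrightarrow> convolution u v \<in> lists (padded_alphabet \<Lambda>)"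
  by (induction u v rule: convolution.induct) (auto simp: padded_alphabet_def)

lemma finite_padded_alphabet_iff: "finite (padded_alphabet \<Lambda>) \<longleftrightarrow> finite \<Lambda>"
proof
  assume "finite (padded_alphabet \<Lambda>)"
  moreover have "(\<lambda>a. (Some a, None)) ` \<Lambda> \<subseteq> padded_alphabet \<Lambda>"
    by (auto simp: padded_alphabet_def)
  ultimately have "finite ((\<lambda>a. (Some a, None :: 'a option)) ` \<Lambda>)" by (rule rev_finite_subset)
  then show "finite \<Lambda>" by (rule finite_imageD) (simp add: inj_on_def)
qed (simp add: padded_alphabet_def)

lemma convolution_mem_iff:
  "convolution u v \<in> {convolution u v | u v. (u, v) \<in> R} \<longleftrightarrow> (u, v) \<in> R"
  by (auto simp: convolution_eq_iff)

text \<open>For words of equal length the convolution of two concatenations is the concatenation of the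
  convolutions, so a quotient of the relation can be read off from one of its language.\<close>

lemma sync_regular_if_regular_relation:
  assumes R: "regular_relation \<Lambda> R"
  shows "sync_regular \<Lambda> R"
proof (rule sync_regularI)
  let ?C = "{convolution u v | u v. (u, v) \<in> R}"
  let ?F = "\<lambda>L. {(s, t). convolution s t \<in> L}"
  have C: "regular_language (padded_alphabet \<Lambda>) ?C" and sub: "R \<subseteq> lists \<Lambda> \<times> lists \<Lambda>"
    using R unfolding regular_relation_def by simp_all
  show "finite \<Lambda>"
    using C unfolding regular_language_def finite_padded_alphabet_iff by simp
  show "R \<subseteq> lists \<Lambda> \<times> lists \<Lambda>" by fact
  have "quot R u v = ?F (lquot ?C (convolution u v))" if len: "length u = length v" for u v
    using convolution_mem_iff[of "u @ _" "v @ _" R]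
    by (simp add: quot_def lquot_def convolution_append[OF len])
  then have "{quot R u v | u v. length u = length v} \<subseteq> ?F ` range (lquot ?C)"
    by (intro subsetI, elim CollectE exE conjE) (erule ssubst, simp)
  then show "finite {quot R u v | u v. length u = length v}"
    by (rule finite_subset) (rule finite_imageI[OF finite_lquot_if_regular[OF C]])
qed

text \<open>As long as both words last, the quotients of the language of convolutions are given by the
  quotients of the relation. After one word has ended, at most \<open>c\<close> letters of the other can follow, so
  that a lagged quotient describes the possible continuations.\<close>

lemma regular_relation_if_sync_regular:
  assumes R: "sync_regular \<Lambda> R" and lag: "lag_bounded c R"
  shows "regular_relation \<Lambda> R"
proof -
  let ?C = "{convolution u v | u v. (u, v) \<in> R}"
  define Q where "Q = {quot R u v | u v. length u \<le> length v + c \<and> length v \<le> length u + c}"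
  have Q: "quot R u v \<in> Q" if "length u \<le> length v + c" "length v \<le> length u + c" for u v
    using that unfolding Q_def by (intro CollectI exI[of _ u] exI[of _ v]) simp
  have finQ: "finite Q" unfolding Q_def by (rule finite_lagged_quot[OF R])
  define F where "F = (\<lambda>P. case_prod convolution ` P) ` Q"
  define F1 where "F1 = (\<lambda>P. convolution [] ` {t. ([], t) \<in> P}) ` Q"
  define F2 where "F2 = (\<lambda>P. (\<lambda>s. convolution s []) ` {s. (s, []) \<in> P}) ` Q"
  have "finite (range (lquot ?C))"
  proof (rule finite_lquot_if_cover)
    show "finite (F \<union> F1 \<union> F2)"
      unfolding F_def F1_def F2_def by (intro finite_UnI finite_imageI finQ)
    fix z y assume "z @ y \<in> ?C"
    then obtain p q where pq: "z @ y = convolution p q" "(p, q) \<in> R" by blast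
    have plag: "length p \<le> length q + c" "length q \<le> length p + c"
      using lag pq(2) by (auto simp: lag_bounded_def)
    define n where "n = length z"
    have n: "n \<le> max (length p) (length q)"
      using arg_cong[OF pq(1), of length] by (simp add: n_def length_convolution)
    consider (both) "n \<le> length p" "n \<le> length q" | (first) "length p < n" "n \<le> length q"
      | (second) "length q < n" "n \<le> length p"
      using n by linarith
    then obtain A where "A \<in> F \<union> F1 \<union> F2" "y \<in> A" "A \<subseteq> lquot ?C z"
    proof cases
      case both
      have "z @ y = convolution (take n p) (take n q) @ convolution (drop n p) (drop n q)"
        using both pq(1) convolution_append[of "take n p" "take n q" "drop n p" "drop n q"] by simp
      then have zy: "z = convolution (take n p) (take n q)" "y = convolution (drop n p) (drop n q)"
        using both by (simp_all add: append_eq_append_conv length_convolution n_def)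
      let ?P = "quot R (take n p) (take n q)"
      show ?thesis
      proof (rule that)
        show "case_prod convolution ` ?P \<in> F \<union> F1 \<union> F2"
          unfolding F_def by (intro UnI1 imageI Q) (use both in simp_all)
        show "y \<in> case_prod convolution ` ?P"
          by (rule image_eqI[of _ _ "(drop n p, drop n q)"]) (simp_all add: zy(2) pq(2))
        show "case_prod convolution ` ?P \<subseteq> lquot ?C z"
        proof clarify
          fix s t assume "(s, t) \<in> ?P"
          then have "convolution (take n p @ s) (take n q @ t) \<in> ?C" 
            unfolding convolution_mem_iff by simp
          then show "convolution s t \<in> lquot ?C z"
            using both by (simp add: lquot_def zy(1) convolution_append)
        qed
      qed
    next
      case first
      have "z @ y = convolution p (take n q) @ convolution [] (drop n q)"
        using first pq(1) convolution_append_right[of p "take n q" "drop n q"] by simp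
      then have zy: "z = convolution p (take n q)" "y = convolution [] (drop n q)"
        using first by (simp_all add: append_eq_append_conv length_convolution n_def)
      let ?P = "quot R p (take n q)"
      show ?thesis
      proof (rule that)
        show "convolution [] ` {t. ([], t) \<in> ?P} \<in> F \<union> F1 \<union> F2"
          unfolding F1_def by (intro UnI1 UnI2 image_eqI[OF refl] Q) (use first plag in simp_all)
        show "y \<in> convolution [] ` {t. ([], t) \<in> ?P}"
          by (rule image_eqI[of _ _ "drop n q"]) (simp_all add: zy(2) pq(2))
        show "convolution [] ` {t. ([], t) \<in> ?P} \<subseteq> lquot ?C z"
        proof clarify
          fix t assume "([], t) \<in> ?P"
          then have "convolution p (take n q @ t) \<in> ?C" 
            unfolding convolution_mem_iff by simp
          then show "convolution [] t \<in> lquot ?C z"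
            using first by (simp add: lquot_def zy(1) convolution_append_right)
        qed
      qed
    next
      case second
      have "z @ y = convolution (take n p) q @ convolution (drop n p) []"
        using second pq(1) convolution_append_left[of q "take n p" "drop n p"] by simp
      then have zy: "z = convolution (take n p) q" "y = convolution (drop n p) []"
        using second by (simp_all add: append_eq_append_conv length_convolution n_def)
      let ?P = "quot R (take n p) q"
      show ?thesis
      proof (rule that)
        show "(\<lambda>s. convolution s []) ` {s. (s, []) \<in> ?P} \<in> F \<union> F1 \<union> F2"
          unfolding F2_def by (intro UnI2 image_eqI[OF refl] Q) (use second plag in simp_all)
        show "y \<in> (\<lambda>s. convolution s []) ` {s. (s, []) \<in> ?P}"
          by (rule image_eqI[of _ _ "drop n p"]) (simp_all add: zy(2) pq(2))
        show "(\<lambda>s. convolution s []) ` {s. (s, []) \<in> ?P} \<subseteq> lquot ?C z"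
        proof clarify
          fix s assume "(s, []) \<in> ?P"
          then have "convolution (take n p @ s) q \<in> ?C" 
            unfolding convolution_mem_iff by simp
          then show "convolution s [] \<in> lquot ?C z"
            using second by (simp add: lquot_def zy(1) convolution_append_left)
        qed
      qed
    qed
    then show "\<exists>A\<in>F \<union> F1 \<union> F2. y \<in> A \<and> A \<subseteq> lquot ?C z" by (intro bexI conjI)
  qed
  moreover have "?C \<subseteq> lists (padded_alphabet \<Lambda>)"
  proof
    fix z assume "z \<in> ?C"
    then obtain u v where z: "z = convolution u v" "(u, v) \<in> R" by blast
    then have "(u, v) \<in> lists \<Lambda> \<times> lists \<Lambda>" using sync_regularD(2)[OF R] by (elim rev_subsetD)
    then show "z \<in> lists (padded_alphabet \<Lambda>)"
      unfolding z(1) by (intro convolution_in_padded) auto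
  qed
  ultimately have "regular_language (padded_alphabet \<Lambda>) ?C"
    using sync_regularD(1)[OF R] by (intro regular_if_finite_lquot) (simp_all add: finite_padded_alphabet_iff)
  then show ?thesis using sync_regularD(2)[OF R] unfolding regular_relation_def by blast
qed

lemma not_inj_on_ordered:
  fixes k :: nat
  assumes "\<not> inj_on f {..k}"
  obtains i j where "i < j" "j \<le> k" "f i = f j"
proof -
  obtain i j where "i \<le> k" "j \<le> k" "f i = f j" "i \<noteq> j"
    using assms unfolding inj_on_def by auto
  then show thesis using that[of i j] that[of j i] by (cases "i < j") auto
qed

text \<open>Pumping: once the first word has been read, a repetition among the quotients met along the
  rest of the second word would make a shorter word another partner of the first one.\<close>

lemma length_bound_if_functional:
  assumes R: "regular_relation \<Lambda> R" and sv: "single_valued R"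
  shows "\<exists>c. \<forall>(u, v)\<in>R. length v \<le> length u + c"
proof -
  define C where "C = {convolution u v | u v. (u, v) \<in> R}"
  have C: "convolution u v \<in> C \<longleftrightarrow> (u, v) \<in> R" for u v
    unfolding C_def by (rule convolution_mem_iff)
  have "regular_language (padded_alphabet \<Lambda>) C"
    using R unfolding regular_relation_def C_def by (rule conjunct2)
  then have fin: "finite (range (lquot C))" by (rule finite_lquot_if_regular)
  define N where "N = card (range (lquot C))"
  have "length v \<le> length u + N" if uv: "(u, v) \<in> R" for u v
  proof (rule ccontr)
    assume long: "\<not> length v \<le> length u + N"
    define f where "f = (\<lambda>i. lquot C (convolution u (take (length u + i) v)))"
    have "\<not> inj_on f {..N}"
    proof
      assume "inj_on f {..N}"
      then have "card {..N} \<le> N"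
        unfolding N_def by (rule card_inj_on_le) (auto simp: f_def fin)
      then show False by simp
    qed
    then obtain i j where ij: "i < j" "j \<le> N" "f i = f j" by (rule not_inj_on_ordered)
    have f: "convolution [] t \<in> f k \<longleftrightarrow> (u, take (length u + k) v @ t) \<in> R" if "k \<le> N" for k t
      using long that unfolding f_def C[symmetric] lquot_def by (simp add: convolution_append_right)
    have "convolution [] (drop (length u + j) v) \<in> f j"
      using ij(2) uv by (simp add: f)
    then have "convolution [] (drop (length u + j) v) \<in> f i"
      by (simp only: ij(3))
    then have "(u, take (length u + i) v @ drop (length u + j) v) \<in> R"
      by (rule iffD1[OF f, rotated]) (use ij in simp)
    with sv uv have "take (length u + i) v @ drop (length u + j) v = v"
      by (intro single_valuedD)
    then have "length (take (length u + i) v @ drop (length u + j) v) = length v" by (rule arg_cong)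
    then show False using ij long by simp
  qed
  then show ?thesis by blast
qed

lemma lag_bounded_if_bijective:
  assumes "regular_relation \<Lambda> R" "regular_relation \<Lambda> (R\<inverse>)" "single_valued R" "single_valued (R\<inverse>)"
  shows "\<exists>c. lag_bounded c R"
proof -
  obtain c d where c: "\<forall>(u, v)\<in>R. length v \<le> length u + c"
    and d: "\<forall>(u, v)\<in>R\<inverse>. length v \<le> length u + d"
    using length_bound_if_functional[OF assms(1,3)] length_bound_if_functional[OF assms(2,4)] by blast
  have "length u \<le> length v + (c + d) \<and> length v \<le> length u + (c + d)" if "(u, v) \<in> R" for u v
    using bspec[OF c that] bspec[OF d converseI[OF that]] by simp
  then have "lag_bounded (c + d) R" unfolding lag_bounded_def by blast
  then show ?thesis ..
qed

section \<open>Words cut into blocks\<close>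

text \<open>With \<open>A = UNIV\<close> this is the Kleene star. Restricting the number of blocks makes it possible to
  speak of positions on the tape modulo a period.\<close>

definition blocks :: "'l list set \<Rightarrow> nat set \<Rightarrow> 'l list set" where
  "blocks B A = {concat bs | bs. bs \<in> lists B \<and> length bs \<in> A}"

lemma blocksI: "bs \<in> lists B \<Longrightarrow> length bs \<in> A \<Longrightarrow> concat bs \<in> blocks B A"
  unfolding blocks_def by (intro CollectI exI[of _ bs]) simp

lemma blocksE:
  assumes "w \<in> blocks B A"
  obtains bs where "w = concat bs" "bs \<in> lists B" "length bs \<in> A"
  using assms unfolding blocks_def by (elim CollectE exE conjE)

text \<open>A prefix of a concatenation ends inside some block; what follows is the rest of this block and
  then a number of blocks from a shifted set \<open>A\<close>.\<close>

lemma regular_language_blocks: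
  assumes B: "regular_language \<Lambda> B" and A: "finite (range (\<lambda>m. {n. m + n \<in> A}))"
  shows "regular_language \<Lambda> (blocks B A)"
proof (rule regular_if_finite_lquot)
  show "finite \<Lambda>" using B unfolding regular_language_def by (rule conjunct1)
  have "B \<subseteq> lists \<Lambda>" using B unfolding regular_language_iff_finite_lquot by simp
  then show "blocks B A \<subseteq> lists \<Lambda>" by (fastforce elim!: blocksE)
  define ext where "ext P N = (\<lambda>(p, w). p @ w) ` (P \<times> blocks B N)" for P N
  define F where "F = (\<lambda>(P, N). ext P N) ` (range (lquot B) \<times> range (\<lambda>m. {n. m + n \<in> A}))"
  show "finite (range (lquot (blocks B A)))"
  proof (rule finite_lquot_if_cover)
    show "finite (insert (blocks B A) F)" unfolding F_def
      by (intro finite.insertI finite_imageI finite_cartesian_product A finite_lquot_if_regular[OF B])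
    fix u s assume us: "u @ s \<in> blocks B A"
    then obtain bs where bs: "u @ s = concat bs" "bs \<in> lists B" "length bs \<in> A" by (rule blocksE)
    show "\<exists>C\<in>insert (blocks B A) F. s \<in> C \<and> C \<subseteq> lquot (blocks B A) u"
    proof (cases "bs = []")
      case True
      then show ?thesis using us bs(1) by (intro bexI[of _ "blocks B A"]) simp_all
    next
      case False
      then obtain bs1 b1 b2 bs2 where split: "bs = bs1 @ (b1 @ b2) # bs2"
        "u = concat bs1 @ b1" "s = b2 @ concat bs2"
        using concat_eq_appendD[OF bs(1)[symmetric]] by blast
      define M where "M = {n. Suc (length bs1) + n \<in> A}"
      have "ext (lquot B b1) M \<in> F" unfolding F_def M_def
        by (intro image_eqI[of _ _ "(lquot B b1, {n. Suc (length bs1) + n \<in> A})"] SigmaI rangeI) simp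
      moreover have "s \<in> ext (lquot B b1) M"
      proof -
        have "b2 \<in> lquot B b1" "concat bs2 \<in> blocks B M"
          using bs split by (auto simp: lquot_def M_def intro!: blocksI)
        then show ?thesis unfolding ext_def split(3)
          by (intro image_eqI[of _ _ "(b2, concat bs2)"] SigmaI) simp_all
      qed
      moreover have "ext (lquot B b1) M \<subseteq> lquot (blocks B A) u"
      proof
        fix x assume "x \<in> ext (lquot B b1) M"
        then obtain p w where x: "x = p @ w" "p \<in> lquot B b1" "w \<in> blocks B M"
          unfolding ext_def by auto
        obtain cs where cs: "w = concat cs" "cs \<in> lists B" "length cs \<in> M"
          using x(3) by (rule blocksE)
        have "concat (bs1 @ (b1 @ p) # cs) \<in> blocks B A"
          using x(2) cs bs split by (intro blocksI) (simp_all add: lquot_def M_def)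
        then show "x \<in> lquot (blocks B A) u" using split cs x by (simp add: lquot_def)
      qed
      ultimately show ?thesis by (intro bexI[of _ "ext (lquot B b1) M"]) simp_all
    qed
  qed
qed

text \<open>The case \<open>D = 0\<close> is the singleton \<open>{r}\<close>; finitely many exceptional positions are thus treated like
  the residue classes.\<close>

definition progression :: "nat \<Rightarrow> nat \<Rightarrow> nat set" where
  "progression r D = {r + i * D | i. True}"

lemma finite_shifts_progression: "finite (range (\<lambda>m. {n. m + n \<in> progression r D}))"
proof -
  let ?c = "\<lambda>m. {n. m + n \<in> progression r D}"
  have "?c m \<in> insert {} (?c ` {..r + D})" for m
  proof (induction m rule: less_induct)
    case (less m)
    show ?case
    proof (cases "m \<le> r + D")
      case False
      have shift: "m + n \<in> progression r D \<longleftrightarrow> D > 0 \<and> m - D + n \<in> progression r D" for n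
      proof (intro iffI conjI)
        assume "m + n \<in> progression r D"
        then obtain i where i: "m + n = r + i * D" by (auto simp: progression_def)
        then show "D > 0" using False by (cases D) auto
        have "m - D + n = r + (i - 1) * D"
          using False i by (cases i) auto
        then show "m - D + n \<in> progression r D" by (auto simp: progression_def)
      next
        assume "D > 0 \<and> m - D + n \<in> progression r D"
        then obtain i where "m - D + n = r + i * D" by (auto simp: progression_def)
        then have "m + n = r + Suc i * D" using False by simp
        then show "m + n \<in> progression r D" unfolding progression_def by blast
      qed
      show ?thesis
      proof (cases "D > 0")
        case True
        then have "?c m = ?c (m - D)" by (simp add: shift)
        then show ?thesis using less[of "m - D"] True False by simp
      qed (use shift in simp)
    qed simp
  qed
  then have "range ?c \<subseteq> insert {} (?c ` {..r + D})" by blast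
  then show ?thesis by (rule finite_subset) simp
qed

lemma sync_regular_mono:
  assumes R: "sync_regular \<Lambda> R" and sub: "\<Lambda> \<subseteq> \<Lambda>'" "finite \<Lambda>'"
  shows "sync_regular \<Lambda>' R"
  by (rule sync_regularI[OF sub(2) _ sync_regularD(3)[OF R]])
    (use sync_regularD(2)[OF R] lists_mono[OF sub(1)] in blast)

lemma lag_bounded_Id_on [simp]: "lag_bounded 0 (Id_on L)"
  by (auto simp: lag_bounded_def)

lemma lag_bounded_singleton [simp]: "lag_bounded 0 {([a], [b])}"
  by (auto simp: lag_bounded_def)

lemma rconcE:
  assumes "(x, y) \<in> A \<frown> B"
  obtains u v s t where "x = u @ s" "y = v @ t" "(u, v) \<in> A" "(s, t) \<in> B"
  using assms unfolding rconc_def by blast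

section \<open>Tapes\<close>

text \<open>The letters \<open>0\<close> and \<open>1\<close> are marks that begin a lamp, \<open>1\<close> being reserved for the lamp at the
  lamplighter. The letters of the words for the lamps are shifted to leave room for the marks.\<close>

definition letters :: "nat list \<Rightarrow> nat list" where
  "letters w = map (\<lambda>a. a + 2) w"

definition lamps :: "nat list list \<Rightarrow> nat list" where
  "lamps ws = concat (map (\<lambda>w. 0 # letters w) ws)"

definition tape :: "nat list list \<Rightarrow> nat \<Rightarrow> nat list" where
  "tape ws k = lamps (take k ws) @ 1 # letters (ws ! k) @ lamps (drop (Suc k) ws)"

lemma lamps_append: "lamps (xs @ ys) = lamps xs @ lamps ys"
  by (simp add: lamps_def)

lemma lamps_simps [simp]: "lamps [] = []" "lamps (w # ws) = 0 # letters w @ lamps ws"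
  by (simp_all add: lamps_def)

lemma inj_letters: "inj letters"
  unfolding letters_def by (rule inj_mapI) (simp add: inj_on_def)

lemma tape_split: "tape (xs @ w # ys) (length xs) = lamps xs @ 1 # letters w @ lamps ys"
  by (simp add: tape_def)

lemma tape_append: "k < length ws \<Longrightarrow> tape (ws @ ws') k = tape ws k @ lamps ws'"
  by (simp add: tape_def lamps_append nth_append)

lemma length_tape:
  assumes "k < length ws"
  shows "length (tape ws k) = length (lamps ws)"
proof -
  have "lamps ws = lamps (take k ws @ ws ! k # drop (Suc k) ws)"
    using id_take_nth_drop[OF assms] by (rule arg_cong)
  then show ?thesis by (simp only: tape_def lamps_append) simp
qed

lemma length_lamps_replicate: "length (lamps (replicate i w)) = i * Suc (length w)"
  by (induction i) (simp_all add: letters_def)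

text \<open>A tape as a list of lamps with Boolean marks; in this form unique readability is an induction on
  the list.\<close>

definition marked :: "(bool \<times> nat list) list \<Rightarrow> nat list" where
  "marked xs = concat (map (\<lambda>(b, w). of_bool b # letters w) xs)"

lemma takeWhile_marked:
  "takeWhile (\<lambda>a. a \<ge> 2) (letters w @ marked xs) = letters w"
  "dropWhile (\<lambda>a. a \<ge> 2) (letters w @ marked xs) = marked xs"
proof -
  have "\<forall>a\<in>set (letters w). a \<ge> 2" by (auto simp: letters_def)
  moreover have "takeWhile (\<lambda>a. a \<ge> 2) (marked xs) = [] \<and> dropWhile (\<lambda>a. a \<ge> 2) (marked xs) = marked xs"
    by (cases xs) (auto simp: marked_def)
  ultimately show "takeWhile (\<lambda>a. a \<ge> 2) (letters w @ marked xs) = letters w"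
    "dropWhile (\<lambda>a. a \<ge> 2) (letters w @ marked xs) = marked xs"
    by (simp_all add: takeWhile_append2 dropWhile_append2)
qed

lemma inj_marked: "inj marked"
proof (rule injI)
  fix xs ys show "marked xs = marked ys \<Longrightarrow> xs = ys"
  proof (induction xs arbitrary: ys)
    case Nil
    then show ?case by (cases ys) (auto simp: marked_def)
  next
    case (Cons x xs)
    obtain b w where x: "x = (b, w)" by (cases x)
    obtain c w' ys' where ys: "ys = (c, w') # ys'"
      using Cons.prems x by (cases ys) (auto simp: marked_def)
    have eq: "b = c" "letters w @ marked xs = letters w' @ marked ys'"
      using Cons.prems x ys by (auto simp: marked_def of_bool_def split: if_splits)
    then have "letters w = letters w'" "marked xs = marked ys'"
      using takeWhile_marked by metis+
    then show ?case using Cons.IH x ys eq(1) injD[OF inj_letters] by simp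
  qed
qed

lemma tape_marked:
  "tape ws k = marked (map (Pair False) (take k ws) @ (True, ws ! k) # map (Pair False) (drop (Suc k) ws))"
proof -
  have "marked (map (Pair False) xs) = lamps xs" for xs
    by (induction xs) (auto simp: marked_def)
  moreover have "marked (xs @ y # ys) = marked xs @ of_bool (fst y) # letters (snd y) @ marked ys" for xs y ys
    by (simp add: marked_def split_beta)
  ultimately show ?thesis by (simp add: tape_def)
qed

lemma tape_eq_iff:
  assumes "k < length ws" "k' < length ws'"
  shows "tape ws k = tape ws' k' \<longleftrightarrow> ws = ws' \<and> k = k'"
proof
  let ?m = "\<lambda>ws k. map (Pair False) (take k ws) @ (True, ws ! k) # map (Pair False) (drop (Suc k) ws)"
  assume "tape ws k = tape ws' k'"
  then have eq: "?m ws k = ?m ws' k'" unfolding tape_marked by (rule injD[OF inj_marked])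
  have "map snd (?m ws k) = ws" if "k < length ws" for ws k
    using id_take_nth_drop[OF that] by (simp add: comp_def)
  moreover have "length (takeWhile (\<lambda>p. \<not> fst p) (?m ws k)) = k" if "k < length ws" for ws k
    using that by (subst takeWhile_append2) auto
  ultimately show "ws = ws' \<and> k = k'" using assms eq by metis
qed simp

locale lamp_words =
  fixes \<Lambda> :: "nat set" and L :: "nat list set" and e :: "nat list"
  assumes regular: "regular_language \<Lambda> L" and e: "e \<in> L"
begin

definition tape_alphabet :: "nat set" where
  "tape_alphabet = {0, 1} \<union> (\<lambda>a. a + 2) ` \<Lambda>"

lemma finite_tape_alphabet: "finite tape_alphabet"
  using regular unfolding tape_alphabet_def regular_language_def by simp

lemma sync_regular_letters:
  assumes "sync_regular \<Lambda> R"
  shows "sync_regular tape_alphabet (map_prod letters letters ` R)"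
proof -
  have "sync_regular ((\<lambda>a. a + 2) ` \<Lambda>) (map_prod letters letters ` R)"
    unfolding letters_def[abs_def] by (rule sync_regular_map[OF assms]) (simp add: inj_on_def)
  then show ?thesis
    by (rule sync_regular_mono[OF _ _ finite_tape_alphabet]) (unfold tape_alphabet_def, rule Un_upper2)
qed

lemma sync_regular_marks:
  assumes "a \<in> {0, 1}" "b \<in> {0, 1}"
  shows "sync_regular tape_alphabet {([a], [b])}"
  by (rule sync_regular_singleton[OF finite_tape_alphabet]) (use assms in \<open>auto simp: tape_alphabet_def\<close>)

text \<open>The parts of a tape that two related tapes share are given as identity relations, ready to be
  combined by \<open>\<frown>\<close>.\<close>

definition words :: "(nat list \<times> nat list) set" where
  "words = Id_on (letters ` L)"

lemma words_regular: "sync_regular tape_alphabet words"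
proof -
  have "words = map_prod letters letters ` Id_on L" unfolding words_def by auto
  then show ?thesis
    using sync_regular_letters[of "Id_on L"] regular by (simp add: sync_regular_Id_on_iff)
qed

definition segments :: "nat set \<Rightarrow> (nat list \<times> nat list) set" where
  "segments A = Id_on (lamps ` {ws \<in> lists L. length ws \<in> A})"

lemma segments_regular:
  assumes "finite (range (\<lambda>m. {n. m + n \<in> A}))"
  shows "sync_regular tape_alphabet (segments A)"
proof -
  let ?B = "(#) 0 ` letters ` L"
  have "{([0], [0])} \<frown> words = Id_on ?B"
    unfolding rconc_def words_def by auto
  moreover have "sync_regular tape_alphabet ({([0], [0])} \<frown> words)"
    by (rule sync_regular_rconc[of _ _ 0]) (auto intro: sync_regular_marks words_regular)
  ultimately have B: "regular_language tape_alphabet ?B"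
    by (simp add: sync_regular_Id_on_iff)
  have "lists ?B = map ((#) 0 \<circ> letters) ` lists L"
    by (simp add: lists_image image_comp comp_def)
  then have "blocks ?B A = lamps ` {ws \<in> lists L. length ws \<in> A}"
    unfolding blocks_def lamps_def by (auto simp: comp_def)
  then show ?thesis
    using regular_language_blocks[OF B assms] by (simp add: segments_def sync_regular_Id_on_iff)
qed

lemma UNIV_progression: "UNIV = progression 0 1"
  by (auto simp: progression_def)

lemma segments_regular_progression: "sync_regular tape_alphabet (segments (progression r D))"
  by (rule segments_regular[OF finite_shifts_progression])

lemma segments_regular_UNIV: "sync_regular tape_alphabet (segments UNIV)"
  unfolding UNIV_progression by (rule segments_regular_progression)

lemma lag_bounded_words_segments [simp]: "lag_bounded 0 words" "lag_bounded 0 (segments A)"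
  by (simp_all add: words_def segments_def)

lemma segments_rconcE:
  assumes "(x, y) \<in> segments A \<frown> B"
  obtains ws s t where "ws \<in> lists L" "length ws \<in> A" "x = lamps ws @ s" "y = lamps ws @ t" "(s, t) \<in> B"
  using assms by (elim rconcE) (auto simp: segments_def)

lemma mark_words_rconcE:
  assumes "(x, y) \<in> {([a], [b])} \<frown> words \<frown> B"
  obtains w s t where "w \<in> L" "x = [a] @ letters w @ s" "y = [b] @ letters w @ t" "(s, t) \<in> B"
  using assms by (elim rconcE) (auto simp: words_def)

text \<open>The marker stays at the same lamp, but the lamps to its right may be displaced, since \<open>v\<close> and
  \<open>ws ! k\<close> may differ in length.\<close>

definition relight :: "(nat list \<times> nat list) set \<Rightarrow> (nat list \<times> nat list) set" where
  "relight R = {(tape ws k, tape (ws[k := v]) k) | ws k v.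
     ws \<in> lists L \<and> k < length ws \<and> (ws ! k, v) \<in> R}"

lemma relight_eq:
  assumes "R \<subseteq> L \<times> L"
  shows "relight R = segments UNIV \<frown> {([1], [1])} \<frown> map_prod letters letters ` R \<frown> segments UNIV"
    (is "_ = ?S")
proof (intro equalityI subrelI)
  fix x y assume "(x, y) \<in> relight R"
  then obtain ws k v where xy: "x = tape ws k" "y = tape (ws[k := v]) k"
    and ws: "ws \<in> lists L" "k < length ws" "(ws ! k, v) \<in> R"
    unfolding relight_def by blast
  have "take k ws \<in> lists L" "drop (Suc k) ws \<in> lists L"
    using ws(1) set_take_subset set_drop_subset by fastforce+
  then have "(lamps (take k ws) @ [1] @ letters (ws ! k) @ lamps (drop (Suc k) ws),
      lamps (take k ws) @ [1] @ letters v @ lamps (drop (Suc k) ws)) \<in> ?S"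
    using ws(3) by (intro rconcI) (auto simp: segments_def)
  then show "(x, y) \<in> ?S" using ws(2) by (simp add: xy tape_def)
next
  fix x y assume "(x, y) \<in> ?S"
  then obtain xs w v ys where *: "xs \<in> lists L" "ys \<in> lists L" "(w, v) \<in> R"
    "x = lamps xs @ [1] @ letters w @ lamps ys" "y = lamps xs @ [1] @ letters v @ lamps ys"
    by (elim rconcE) (auto simp: segments_def)
  have "x = tape (xs @ w # ys) (length xs)" "y = tape ((xs @ w # ys)[length xs := v]) (length xs)"
    using * by (simp_all add: tape_split)
  moreover have "xs @ w # ys \<in> lists L" using * assms by auto
  ultimately show "(x, y) \<in> relight R"
    unfolding relight_def using *(3)
    by (intro CollectI exI[of _ "xs @ w # ys"] exI[of _ "length xs"] exI[of _ v]) simp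
qed

lemma relight_regular:
  assumes R: "sync_regular \<Lambda> R" "R \<subseteq> L \<times> L" "lag_bounded c R"
  shows "sync_regular tape_alphabet (relight R)" "lag_bounded c (relight R)"
proof -
  have lag: "lag_bounded c (map_prod letters letters ` R)"
    using R(3) unfolding lag_bounded_def letters_def by fastforce
  show "sync_regular tape_alphabet (relight R)"
    unfolding relight_eq[OF R(2)]
    by (rule sync_regular_rconc lag_bounded_words_segments lag_bounded_singleton lag
      segments_regular_UNIV sync_regular_letters R(1) sync_regular_marks | simp)+
  have "lag_bounded (0 + (0 + (c + 0))) (relight R)"
    unfolding relight_eq[OF R(2)]
    by (rule lag_bounded_rconc lag_bounded_words_segments lag_bounded_singleton lag)+
  then show "lag_bounded c (relight R)" by simp
qed

text \<open>The displacement \<open>r' - r\<close> of the marker is the same for all \<open>i\<close>, which is what makes these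
  relations regular.\<close>

definition move :: "nat \<Rightarrow> nat \<Rightarrow> nat \<Rightarrow> (nat list \<times> nat list) set" where
  "move D r r' = {(tape ws (r + i * D), tape ws (r' + i * D)) | ws i.
     ws \<in> lists L \<and> r + i * D < length ws \<and> r' + i * D < length ws}"

text \<open>The tape is split at the old and at the new place of the marker; the number of lamps strictly
  between them is constant.\<close>

lemma move_right_eq:
  assumes "r < r'"
  shows "move D r r' = segments (progression r D) \<frown> {([1], [0])} \<frown> words \<frown>
    segments (progression (r' - r - 1) 0) \<frown> {([0], [1])} \<frown> words \<frown> segments UNIV"
    (is "_ = ?S")
proof (intro equalityI subrelI)
  fix x y assume "(x, y) \<in> move D r r'"
  then obtain ws i where xy: "x = tape ws (r + i * D)" "y = tape ws (r' + i * D)"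
    and ws: "ws \<in> lists L" "r' + i * D < length ws"
    unfolding move_def by blast
  define k d where "k = r + i * D" and "d = r' - r - 1"
  have k: "r' + i * D = k + Suc d" using assms by (simp add: k_def d_def)
  define xs w where "xs = take k ws" and "w = ws ! k"
  define ys w' zs where "ys = take d (drop (Suc k) ws)" and "w' = ws ! (k + Suc d)"
    and "zs = drop (Suc d) (drop (Suc k) ws)"
  have "drop (Suc k) ws = ys @ w' # zs"
    using ws(2) unfolding k ys_def w'_def zs_def
    by (subst id_take_nth_drop[of d]) simp_all
  then have split: "ws = xs @ w # ys @ w' # zs"
    using ws(2) id_take_nth_drop[of k ws] unfolding k xs_def w_def by simp
  have len: "length xs = k" "length ys = d" using ws(2) unfolding k xs_def ys_def by simp_all
  have x: "x = lamps xs @ [1] @ letters w @ lamps ys @ [0] @ letters w' @ lamps zs"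
    unfolding xy(1) k_def[symmetric] len(1)[symmetric]
    by (subst split, subst tape_split) (simp add: lamps_append)
  have y: "y = lamps xs @ [0] @ letters w @ lamps ys @ [1] @ letters w' @ lamps zs"
    using tape_split[of "xs @ w # ys" w' zs] unfolding xy(2) k
    by (subst split) (simp add: lamps_append len)
  have "set ws \<subseteq> L" using ws(1) by auto
  then have mem: "set xs \<subseteq> L" "w \<in> L" "set ys \<subseteq> L" "w' \<in> L" "set zs \<subseteq> L"
    unfolding split by auto
  have "k \<in> progression r D" "d \<in> progression d 0" by (auto simp: progression_def k_def)
  then show "(x, y) \<in> ?S" unfolding x y d_def[symmetric]
    using mem len by (intro rconcI) (auto simp: segments_def words_def)
next
  fix x y assume "(x, y) \<in> ?S"
  then obtain xs s1 t1 where 1: "xs \<in> lists L" "length xs \<in> progression r D"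
    "x = lamps xs @ s1" "y = lamps xs @ t1" "(s1, t1) \<in> {([1], [0])} \<frown> words \<frown>
    segments (progression (r' - r - 1) 0) \<frown> {([0], [1])} \<frown> words \<frown> segments UNIV"
    by (rule segments_rconcE)
  from 1(5) obtain w s2 t2 where 2: "w \<in> L" "s1 = [1] @ letters w @ s2" "t1 = [0] @ letters w @ t2"
    "(s2, t2) \<in> segments (progression (r' - r - 1) 0) \<frown> {([0], [1])} \<frown> words \<frown> segments UNIV"
    by (rule mark_words_rconcE)
  from 2(4) obtain ys s3 t3 where 3: "ys \<in> lists L" "length ys \<in> progression (r' - r - 1) 0"
    "s2 = lamps ys @ s3" "t2 = lamps ys @ t3" "(s3, t3) \<in> {([0], [1])} \<frown> words \<frown> segments UNIV"
    by (rule segments_rconcE)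
  from 3(5) obtain w' s4 t4 where 4: "w' \<in> L" "s3 = [0] @ letters w' @ s4" "t3 = [1] @ letters w' @ t4"
    "(s4, t4) \<in> segments UNIV"
    by (rule mark_words_rconcE)
  from 4(4) obtain zs where 5: "zs \<in> lists L" "s4 = lamps zs" "t4 = lamps zs"
    unfolding segments_def by auto
  have mem: "xs \<in> lists L" "w \<in> L" "ys \<in> lists L" "w' \<in> L" "zs \<in> lists L"
    and len: "length xs \<in> progression r D" "length ys \<in> progression (r' - r - 1) 0"
    by fact+
  have x: "x = lamps xs @ [1] @ letters w @ lamps ys @ [0] @ letters w' @ lamps zs"
    and y: "y = lamps xs @ [0] @ letters w @ lamps ys @ [1] @ letters w' @ lamps zs"
    by (simp_all only: 1 2 3 4 5)
  obtain i where i: "length xs = r + i * D" "length (xs @ w # ys) = r' + i * D"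
    using len assms by (auto simp: progression_def)
  let ?ws = "xs @ w # ys @ w' # zs"
  have "x = tape ?ws (r + i * D)" unfolding i[symmetric] by (simp only: tape_split) (simp add: x lamps_append)
  moreover have "y = tape ?ws (r' + i * D)"
    using tape_split[of "xs @ w # ys" w' zs] unfolding i[symmetric] by (simp add: y lamps_append)
  moreover have "?ws \<in> lists L" using mem by simp
  moreover have "r' + i * D < length ?ws" unfolding i[symmetric] by simp
  ultimately show "(x, y) \<in> move D r r'"
    unfolding move_def using assms
    by (intro CollectI exI[of _ ?ws] exI[of _ i]) simp
qed

lemma move_stay_eq:
  "move D r r = segments (progression r D) \<frown> {([1], [1])} \<frown> words \<frown> segments UNIV"
    (is "_ = ?S")
proof (intro equalityI subrelI)
  fix x y assume "(x, y) \<in> move D r r"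
  then obtain ws k where xy: "x = tape ws k" "y = tape ws k" "k \<in> progression r D"
    and ws: "ws \<in> lists L" "k < length ws"
    unfolding move_def progression_def by blast
  have "take k ws \<in> lists L" "drop (Suc k) ws \<in> lists L"
    using ws(1) set_take_subset set_drop_subset by fastforce+
  then have "(lamps (take k ws) @ [1] @ letters (ws ! k) @ lamps (drop (Suc k) ws),
      lamps (take k ws) @ [1] @ letters (ws ! k) @ lamps (drop (Suc k) ws)) \<in> ?S"
    using ws xy(3) by (intro rconcI) (auto simp: segments_def words_def)
  then show "(x, y) \<in> ?S" by (simp add: xy tape_def)
next
  fix x y assume "(x, y) \<in> ?S"
  then obtain xs w ys where *: "xs \<in> lists L" "ys \<in> lists L" "w \<in> L" "length xs \<in> progression r D"
    "x = lamps xs @ [1] @ letters w @ lamps ys" "y = lamps xs @ [1] @ letters w @ lamps ys"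
    by (elim rconcE) (auto simp: segments_def words_def)
  obtain i where i: "length xs = r + i * D" using *(4) by (auto simp: progression_def)
  have "x = tape (xs @ w # ys) (r + i * D)" "y = tape (xs @ w # ys) (r + i * D)"
    using * by (simp_all add: tape_split flip: i)
  moreover have "xs @ w # ys \<in> lists L" "r + i * D < length (xs @ w # ys)" using * i by auto
  ultimately show "(x, y) \<in> move D r r"
    unfolding move_def by blast
qed

lemma move_converse: "(move D r r')\<inverse> = move D r' r"
  unfolding move_def by blast

lemma move_regular: "sync_regular tape_alphabet (move D r r')"
proof -
  have right: "sync_regular tape_alphabet (move D r r')" if "r < r'" for r r'
    unfolding move_right_eq[OF that]
    by (rule sync_regular_rconc lag_bounded_words_segments lag_bounded_singleton
      segments_regular_UNIV segments_regular_progression words_regular sync_regular_marks | simp)+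
  have "sync_regular tape_alphabet (move D r r)"
    unfolding move_stay_eq
    by (rule sync_regular_rconc lag_bounded_words_segments lag_bounded_singleton
      segments_regular_UNIV segments_regular_progression words_regular sync_regular_marks | simp)+
  then show ?thesis
    using right[of r r'] sync_regular_converse[OF right[of r' r]] unfolding move_converse
    by (cases r r' rule: linorder_cases) auto
qed

end

context lamp_words
begin

section \<open>Trimmed tapes as codes of configurations\<close>

text \<open>In a configuration \<open>(f, k)\<close>, the lamp with index \<open>i\<close> is described by the word \<open>f i\<close>, and the
  lamplighter stands at \<open>k\<close>. The word \<open>e\<close> describes a lamp in the neutral state.\<close>

definition configs :: "((nat \<Rightarrow> nat list) \<times> nat) set" where
  "configs = {(f, k). (\<forall>i. f i \<in> L) \<and> finite {i. f i \<noteq> e}}"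

text \<open>The shortest tape that shows the lamplighter and all lamps that are not neutral; using it makes
  the code of a configuration unique.\<close>

definition extent :: "(nat \<Rightarrow> nat list) \<Rightarrow> nat \<Rightarrow> nat" where
  "extent f k = (LEAST N. k < N \<and> (\<forall>i\<ge>N. f i = e))"

definition code :: "(nat \<Rightarrow> nat list) \<times> nat \<Rightarrow> nat list" where
  "code = (\<lambda>(f, k). tape (map f [0..<extent f k]) k)"

definition pad :: "nat list list \<Rightarrow> nat \<Rightarrow> nat list" where
  "pad ws i = (if i < length ws then ws ! i else e)"

lemma extent:
  assumes "finite {i. f i \<noteq> e}"
  shows "k < extent f k" "\<And>i. extent f k \<le> i \<Longrightarrow> f i = e"
proof -
  obtain N where N: "\<forall>i\<in>{i. f i \<noteq> e}. i \<le> N"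
    using iffD1[OF finite_nat_set_iff_bounded_le assms] ..
  have "f i = e" if "max (Suc N) (Suc k) \<le> i" for i
    using bspec[OF N, of i] that by (cases "f i = e") simp_all
  then have "k < max (Suc N) (Suc k) \<and> (\<forall>i\<ge>max (Suc N) (Suc k). f i = e)" by simp
  then have "k < extent f k \<and> (\<forall>i\<ge>extent f k. f i = e)"
    unfolding extent_def by (rule LeastI)
  then show "k < extent f k" "\<And>i. extent f k \<le> i \<Longrightarrow> f i = e" by simp_all
qed

lemma extent_le: "k < N \<Longrightarrow> (\<And>i. i \<ge> N \<Longrightarrow> f i = e) \<Longrightarrow> extent f k \<le> N"
  unfolding extent_def by (rule Least_le) blast

lemma pad_map_replicate:
  assumes "\<And>i. i \<ge> N \<Longrightarrow> f i = e"
  shows "pad (map f [0..<N] @ replicate j e) = f"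
  by (rule ext) (use assms in \<open>auto simp: pad_def nth_append\<close>)

lemma pad_map:
  assumes "\<And>i. i \<ge> N \<Longrightarrow> f i = e"
  shows "pad (map f [0..<N]) = f"
  using pad_map_replicate[of N f 0] assms by simp

lemma code_eq_tape_iff:
  assumes "finite {i. f i \<noteq> e}" "j < length ws"
  shows "code (f, k) = tape ws j \<longleftrightarrow> map f [0..<extent f k] = ws \<and> k = j"
  using tape_eq_iff[of k "map f [0..<extent f k]" j ws] extent(1)[OF assms(1), of k] assms(2)
  by (auto simp: code_def)

lemma inj_on_code: "inj_on code configs"
proof (rule inj_onI, clarify)
  fix f k g j assume fg: "(f, k) \<in> configs" "(g, j) \<in> configs" and eq: "code (f, k) = code (g, j)"
  have fin: "finite {i. f i \<noteq> e}" "finite {i. g i \<noteq> e}"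
    using fg unfolding configs_def by auto
  have "code (f, k) = tape (map g [0..<extent g j]) j" using eq by (simp add: code_def)
  then have "map f [0..<extent f k] = map g [0..<extent g j] \<and> k = j"
    by (rule iffD1[OF code_eq_tape_iff[OF fin(1)], rotated]) (simp add: extent(1)[OF fin(2)])
  moreover have "pad (map f [0..<extent f k]) = f" "pad (map g [0..<extent g j]) = g"
    by (rule pad_map, erule extent(2)[OF fin(1)], rule pad_map, erule extent(2)[OF fin(2)])
  ultimately show "f = g \<and> k = j" by metis
qed

definition tapes :: "nat list set" where
  "tapes = {tape ws k | ws k. ws \<in> lists L \<and> k < length ws}"

lemma code_in_tapes: "(f, k) \<in> configs \<Longrightarrow> code (f, k) \<in> tapes"
  unfolding code_def tapes_def configs_def using extent(1)[of f k]
  by (auto intro!: exI[of _ "map f [0..<extent f k]"] exI[of _ k])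

text \<open>A tape fails to be trimmed exactly if it ends with an unmarked neutral lamp, and then the rest of
  it is again a tape. This describes the codes without reference to \<open>extent\<close>.\<close>

lemma codes_eq: "code ` configs = tapes - {x. \<exists>y\<in>tapes. x = y @ lamps [e]}"
proof (intro equalityI subsetI)
  fix x assume "x \<in> code ` configs"
  then obtain f k where x: "x = code (f, k)" and fk: "(f, k) \<in> configs" by auto
  have fin: "finite {i. f i \<noteq> e}" using fk by (simp add: configs_def)
  have "x \<noteq> tape ws j @ lamps [e]" if j: "j < length ws" for ws j
  proof
    assume "x = tape ws j @ lamps [e]"
    then have "code (f, k) = tape (ws @ [e]) j" by (simp add: x tape_append j)
    then have eq: "map f [0..<extent f k] = ws @ [e]" "k = j"
      using code_eq_tape_iff[OF fin, of j "ws @ [e]" k] j by auto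
    have N: "extent f k = Suc (length ws)" using arg_cong[OF eq(1), of length] by simp
    have "f (length ws) = e" using arg_cong[OF eq(1), of last] by (simp add: N)
    then have "f i = e" if "i \<ge> length ws" for i
      using that extent(2)[OF fin, of k i] unfolding N by (cases "i = length ws") auto
    then have "extent f k \<le> length ws" using j eq(2) by (intro extent_le) auto
    then show False using N by simp
  qed
  then show "x \<in> tapes - {x. \<exists>y\<in>tapes. x = y @ lamps [e]}"
    using code_in_tapes[OF fk] unfolding x tapes_def by blast
next
  fix x assume "x \<in> tapes - {x. \<exists>y\<in>tapes. x = y @ lamps [e]}"
  then obtain ws k where x: "x = tape ws k" and ws: "ws \<in> lists L" "k < length ws"
    and nex: "\<And>y. y \<in> tapes \<Longrightarrow> x \<noteq> y @ lamps [e]"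
    unfolding tapes_def by blast
  have sub: "{i. pad ws i \<noteq> e} \<subseteq> {..<length ws}" unfolding pad_def by auto
  have fin: "finite {i. pad ws i \<noteq> e}" by (rule finite_subset[OF sub]) simp
  have le: "extent (pad ws) k \<le> length ws" by (rule extent_le) (auto simp: ws pad_def)
  have "extent (pad ws) k = length ws"
  proof (rule ccontr)
    assume "extent (pad ws) k \<noteq> length ws"
    then have less: "extent (pad ws) k < length ws" using le by simp
    define vs where "vs = butlast ws"
    have "ws \<noteq> []" using ws(2) by auto
    moreover have "last ws = e"
    proof -
      have "pad ws (length ws - 1) = e" by (rule extent(2)[OF fin, of k]) (use less in simp)
      then show ?thesis using \<open>ws \<noteq> []\<close> by (simp add: pad_def last_conv_nth)
    qed
    ultimately have split: "ws = vs @ [e]" unfolding vs_def by (metis append_butlast_last_id)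
    have k: "k < length vs" using extent(1)[OF fin, of k] less split by simp
    have "x = tape vs k @ lamps [e]" unfolding x split using k by (rule tape_append)
    moreover have "tape vs k \<in> tapes" using ws(1) k unfolding split tapes_def by auto
    ultimately show False using nex by blast
  qed
  moreover have "map (pad ws) [0..<length ws] = ws"
    by (rule nth_equalityI) (simp_all add: pad_def)
  ultimately have "x = code (pad ws, k)" by (simp add: x code_def)
  moreover have "(pad ws, k) \<in> configs"
    using ws(1) e fin unfolding configs_def pad_def by auto
  ultimately show "x \<in> code ` configs" by blast
qed

lemma tapes_regular: "regular_language tape_alphabet tapes"
proof -
  have "relight (Id_on L) = Id_on tapes"
  proof (intro equalityI subrelI)
    fix x y assume "(x, y) \<in> relight (Id_on L)"
    then show "(x, y) \<in> Id_on tapes" unfolding relight_def tapes_def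
      by (elim CollectE exE conjE IdE Id_onE) (simp, blast)
  next
    fix x y assume "(x, y) \<in> Id_on tapes"
    then obtain ws k where "x = tape ws k" "y = tape ws k" "ws \<in> lists L" "k < length ws"
      unfolding tapes_def by auto
    then show "(x, y) \<in> relight (Id_on L)" unfolding relight_def
      by (intro CollectI exI[of _ ws] exI[of _ k] exI[of _ "ws ! k"]) (auto simp: in_lists_conv_set)
  qed
  then show ?thesis
    using relight_regular(1)[of "Id_on L" 0] regular by (auto simp flip: sync_regular_Id_on_iff)
qed

lemma codes_regular: "regular_language tape_alphabet (code ` configs)"
proof -
  have "Id_on {x. \<exists>y\<in>tapes. x = y @ lamps [e]} = Id_on tapes \<frown> {(lamps [e], lamps [e])}"
    unfolding rconc_def by auto
  moreover have "sync_regular tape_alphabet (Id_on tapes \<frown> {(lamps [e], lamps [e])})"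
  proof (rule sync_regular_rconc[of _ _ 0])
    have "set e \<subseteq> \<Lambda>" using regular e unfolding regular_language_iff_finite_lquot by auto
    then have "set (lamps [e]) \<subseteq> tape_alphabet" by (auto simp: tape_alphabet_def letters_def)
    then show "sync_regular tape_alphabet {(lamps [e], lamps [e])}"
      by (intro sync_regular_singleton finite_tape_alphabet)
  qed (simp_all add: sync_regular_Id_on_iff tapes_regular)
  ultimately show ?thesis
    unfolding codes_eq by (intro regular_language_Diff tapes_regular) (simp flip: sync_regular_Id_on_iff)
qed

text \<open>The extent depends only on the marker and on the lamps beyond it, so changing the lamp at the
  marker keeps a trimmed tape trimmed.\<close>

lemma relight_codes_regular:
  assumes R: "sync_regular \<Lambda> R" "R \<subseteq> L \<times> L" "lag_bounded c R"
  shows "regular_relation tape_alphabet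
    {(code (f, k), code (f(k := v), k)) | f k v. (f, k) \<in> configs \<and> (f k, v) \<in> R}"
    (is "regular_relation _ ?S")
proof -
  have "?S = relight R \<inter> code ` configs \<times> code ` configs"
  proof (intro equalityI subrelI)
    fix x y assume "(x, y) \<in> ?S"
    then obtain f k v where xy: "x = code (f, k)" "y = code (f(k := v), k)"
      and fk: "(f, k) \<in> configs" "(f k, v) \<in> R" by auto
    have fin: "finite {i. f i \<noteq> e}" and sub: "\<forall>i. f i \<in> L" using fk by (simp_all add: configs_def)
    have ext: "extent (f(k := v)) k = extent f k"
      unfolding extent_def by (rule arg_cong[of _ _ Least]) auto
    have "map (f(k := v)) [0..<extent f k] = (map f [0..<extent f k])[k := v]"
      using extent(1)[OF fin, of k] by (intro nth_equalityI) (auto simp: nth_list_update)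
    then have "(x, y) \<in> relight R"
      unfolding relight_def xy code_def ext prod.case
      using fk sub extent(1)[OF fin, of k]
      by (intro CollectI exI[of _ "map f [0..<extent f k]"] exI[of _ k] exI[of _ v]) auto
    moreover have "(f(k := v), k) \<in> configs"
      using fk R(2) sub fin by (auto simp: configs_def intro: finite_subset[of _ "insert k {i. f i \<noteq> e}"])
    ultimately show "(x, y) \<in> relight R \<inter> code ` configs \<times> code ` configs"
      using fk xy by blast
  next
    fix x y assume "(x, y) \<in> relight R \<inter> code ` configs \<times> code ` configs"
    then obtain ws k v f j g l where xy: "x = tape ws k" "y = tape (ws[k := v]) k"
      and ws: "k < length ws" "(ws ! k, v) \<in> R"
      and f: "x = code (f, j)" "(f, j) \<in> configs" and g: "y = code (g, l)" "(g, l) \<in> configs"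
      unfolding relight_def by auto
    have fin: "finite {i. f i \<noteq> e}" "finite {i. g i \<noteq> e}"
      using f g by (simp_all add: configs_def)
    have "code (f, j) = tape ws k" using xy f by simp
    then have f_eq: "map f [0..<extent f j] = ws" "j = k"
      using code_eq_tape_iff[OF fin(1) ws(1)] by blast+
    have "code (g, l) = tape (ws[k := v]) k" using xy g by simp
    then have g_eq: "map g [0..<extent g l] = ws[k := v]" "l = k"
      using code_eq_tape_iff[OF fin(2), of k "ws[k := v]" l] ws(1) by simp_all blast+
    have "pad ws = f"
      unfolding f_eq(1)[symmetric] by (rule pad_map) (erule extent(2)[OF fin(1)])
    moreover have "pad (ws[k := v]) = g"
      unfolding g_eq(1)[symmetric] by (rule pad_map) (erule extent(2)[OF fin(2)])
    moreover have "pad (ws[k := v]) = (pad ws)(k := v)"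
      using ws(1) by (auto simp: pad_def fun_eq_iff)
    ultimately have "g = f(k := v)" "f k = ws ! k" using ws(1) by (auto simp: pad_def)
    then show "(x, y) \<in> ?S"
      using f g f_eq(2) g_eq(2) ws(2) by (intro CollectI exI[of _ f] exI[of _ k] exI[of _ v]) simp
  qed
  moreover have "sync_regular tape_alphabet (relight R \<inter> code ` configs \<times> code ` configs)"
    by (rule sync_regular_restrict[OF relight_regular(1)[OF R] codes_regular])
  moreover have "lag_bounded c (relight R \<inter> code ` configs \<times> code ` configs)"
    using relight_regular(2)[OF R] unfolding lag_bounded_def by blast
  ultimately show ?thesis using regular_relation_if_sync_regular by simp
qed

lemma periodic_shift:
  fixes \<sigma> :: "nat \<Rightarrow> nat"
  assumes "\<And>k. k \<ge> b \<Longrightarrow> \<sigma> (k + D) = \<sigma> k + D" "k \<ge> b"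
  shows "\<sigma> (k + i * D) = \<sigma> k + i * D"
proof (induction i)
  case (Suc i)
  have "\<sigma> (k + Suc i * D) = \<sigma> ((k + i * D) + D)" by (simp add: algebra_simps)
  also have "\<dots> = \<sigma> (k + i * D) + D" by (rule assms(1)) (use assms(2) in simp)
  finally show ?case using Suc by simp
qed simp

text \<open>Every index is represented by one below \<open>b + D\<close>, and by itself if it is below \<open>b\<close>.\<close>

lemma periodic_reduce:
  fixes \<sigma> :: "nat \<Rightarrow> nat"
  assumes per: "\<And>k. k \<ge> b \<Longrightarrow> \<sigma> (k + D) = \<sigma> k + D" and D: "D > 0"
  obtains r i where "r < b + D" "k = r + i * D" "\<sigma> k = \<sigma> r + i * D" "r < b \<longrightarrow> i = 0"
proof (cases "k < b")
  case True
  then show ?thesis using that[of k 0] by simp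
next
  case False
  define r i where "r = b + (k - b) mod D" and "i = (k - b) div D"
  have k: "k = r + i * D" using False by (simp add: r_def i_def)
  have "\<sigma> (r + i * D) = \<sigma> r + i * D"
    by (rule periodic_shift[of b \<sigma> D, OF per]) (simp_all add: r_def)
  then have "\<sigma> k = \<sigma> r + i * D" by (simp flip: k)
  moreover have "r < b + D" "\<not> r < b" using D by (simp_all add: r_def)
  ultimately show ?thesis using k by (intro that[of r i]) simp_all
qed

definition move_along :: "(nat \<Rightarrow> nat) \<Rightarrow> (nat list \<times> nat list) set" where
  "move_along \<sigma> = {(tape ws k, tape ws (\<sigma> k)) | ws k.
     ws \<in> lists L \<and> k < length ws \<and> \<sigma> k < length ws}"

text \<open>Each of the finitely many positions below \<open>b\<close> is treated on its own; the others fall into \<open>D\<close>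
  classes, on each of which \<open>\<sigma>\<close> is a translation.\<close>

lemma move_along_regular:
  assumes per: "\<And>k. k \<ge> b \<Longrightarrow> \<sigma> (k + D) = \<sigma> k + D" and D: "D > 0"
  shows "sync_regular tape_alphabet (move_along \<sigma>)"
proof -
  have "move_along \<sigma> = (\<Union>r\<in>{..<b}. move 0 r (\<sigma> r)) \<union> (\<Union>r\<in>{b..<b + D}. move D r (\<sigma> r))"
    (is "_ = ?A \<union> ?B")
  proof (intro equalityI subrelI)
    fix x y assume "(x, y) \<in> move_along \<sigma>"
    then obtain ws k where xy: "x = tape ws k" "y = tape ws (\<sigma> k)"
      and ws: "ws \<in> lists L" "k < length ws" "\<sigma> k < length ws"
      unfolding move_along_def by blast
    obtain r i where r: "r < b + D" "k = r + i * D" "\<sigma> k = \<sigma> r + i * D" "r < b \<longrightarrow> i = 0"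
      by (rule periodic_reduce[of b \<sigma> D k, OF per D])
    show "(x, y) \<in> ?A \<union> ?B"
    proof (cases "r < b")
      case True
      then have "(x, y) \<in> move 0 r (\<sigma> r)"
        using ws r unfolding xy move_def by (intro CollectI exI[of _ ws] exI[of _ 0]) simp
      then show ?thesis using True by blast
    next
      case False
      have "(x, y) \<in> move D r (\<sigma> r)"
        using ws r unfolding xy move_def by (intro CollectI exI[of _ ws] exI[of _ i]) simp
      then show ?thesis using False r(1) by auto
    qed
  next
    fix x y assume "(x, y) \<in> ?A \<union> ?B"
    then obtain ws k where "(x, y) = (tape ws k, tape ws (\<sigma> k))"
      "ws \<in> lists L" "k < length ws" "\<sigma> k < length ws"
    proof (elim UnE UN_E)
      fix r assume "(x, y) \<in> move 0 r (\<sigma> r)"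
      then obtain ws where "(x, y) = (tape ws r, tape ws (\<sigma> r))"
        "ws \<in> lists L" "r < length ws" "\<sigma> r < length ws"
        unfolding move_def mult_0_right add_0_right by blast
      then show thesis by (rule that)
    next
      fix r assume r: "r \<in> {b..<b + D}" and "(x, y) \<in> move D r (\<sigma> r)"
      then obtain ws i where "(x, y) = (tape ws (r + i * D), tape ws (\<sigma> r + i * D))"
        "ws \<in> lists L" "r + i * D < length ws" "\<sigma> r + i * D < length ws"
        unfolding move_def by blast
      moreover have "\<sigma> (r + i * D) = \<sigma> r + i * D" 
        by (rule periodic_shift[of b \<sigma> D, OF per]) (use r in simp_all)
      ultimately show thesis using that[of ws "r + i * D"] by simp
    qed
    then show "(x, y) \<in> move_along \<sigma>" unfolding move_along_def
      by (intro CollectI exI[of _ ws] exI[of _ k]) simp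
  qed
  then show ?thesis
    by (simp add: sync_regular_Un sync_regular_UN finite_tape_alphabet move_regular)
qed

text \<open>The trimmed tapes before and after the move may differ in length. After neutral lamps have been
  appended to both, they have equally many lamps and are related by \<open>move_along\<close>. Since \<open>\<sigma>\<close>
  displaces the marker by at most \<open>c\<close>, appending at most \<open>c\<close> lamps suffices, and this also bounds the
  difference of the lengths.\<close>

lemma move_codes_regular:
  assumes per: "\<And>k. k \<ge> b \<Longrightarrow> \<sigma> (k + D) = \<sigma> k + D" and D: "D > 0"
  shows "regular_relation tape_alphabet {(code (f, k), code (f, \<sigma> k)) | f k. (f, k) \<in> configs}"
    (is "regular_relation _ ?S")
proof -
  obtain c where c: "\<And>k. k \<le> \<sigma> k + c" "\<And>k. \<sigma> k \<le> k + c"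
  proof
    define c where "c = Max ((\<lambda>r. max r (\<sigma> r)) ` {..<b + D})"
    fix k
    obtain r i where r: "r < b + D" "k = r + i * D" "\<sigma> k = \<sigma> r + i * D"
      using periodic_reduce[of b \<sigma> D k, OF per D] by metis
    have "max r (\<sigma> r) \<le> c" unfolding c_def by (rule Max_ge) (use r(1) in auto)
    then show "k \<le> \<sigma> k + c" "\<sigma> k \<le> k + c" using r by simp_all
  qed
  define blank where "blank i = lamps (replicate i e)" for i
  define Q where "Q = (\<Union>(i, j)\<in>{..c} \<times> {..c}. {(x, y). (x @ blank i, y @ blank j) \<in> move_along \<sigma>})"
  have "?S = Q \<inter> code ` configs \<times> code ` configs"
  proof (intro equalityI subrelI)
    fix x y assume "(x, y) \<in> ?S"
    then obtain f k where xy: "x = code (f, k)" "y = code (f, \<sigma> k)" and fk: "(f, k) \<in> configs" by auto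
    have fin: "finite {i. f i \<noteq> e}" and sub: "\<forall>i. f i \<in> L" using fk by (simp_all add: configs_def)
    define N N' where "N = extent f k" and "N' = extent f (\<sigma> k)"
    define M where "M = max N N'"
    note N = extent[OF fin, of k, folded N_def] and N' = extent[OF fin, of "\<sigma> k", folded N'_def]
    have "N \<le> max N' (Suc k)" unfolding N_def using N'(2) by (intro extent_le) auto
    moreover have "N' \<le> max N (Suc (\<sigma> k))" unfolding N'_def using N(2) by (intro extent_le) auto
    ultimately have "N \<le> N' + c" "N' \<le> N + c"
      using N(1) N'(1) c[of k] by (auto simp: le_max_iff_disj)
    then have bounds: "M - N \<le> c" "M - N' \<le> c" unfolding M_def by simp_all
    have extend: "tape (map f [0..<m]) j @ blank (M - m) = tape (map f [0..<M]) j"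
      if m: "m \<le> M" "j < m" and tail: "\<And>i. m \<le> i \<Longrightarrow> f i = e" for m j
    proof -
      have "map f [0..<M] = map f [0..<m] @ replicate (M - m) e"
        using m tail by (intro nth_equalityI) (simp_all add: nth_append)
      then show ?thesis using m(2) by (simp add: blank_def tape_append)
    qed
    have "x @ blank (M - N) = tape (map f [0..<M]) k"
      unfolding xy code_def prod.case N_def[symmetric]
      by (rule extend[OF _ N]) (simp add: M_def)
    moreover have "y @ blank (M - N') = tape (map f [0..<M]) (\<sigma> k)"
      unfolding xy code_def prod.case N'_def[symmetric]
      by (rule extend[OF _ N']) (simp add: M_def)
    moreover have "(tape (map f [0..<M]) k, tape (map f [0..<M]) (\<sigma> k)) \<in> move_along \<sigma>"
      unfolding move_along_def using sub N(1) N'(1)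
      by (intro CollectI exI[of _ "map f [0..<M]"] exI[of _ k]) (auto simp: M_def)
    ultimately have "(x, y) \<in> Q" unfolding Q_def using bounds
      by (intro UN_I[of "(M - N, M - N')"]) auto
    moreover have "(f, \<sigma> k) \<in> configs" using fk by (simp add: configs_def)
    ultimately show "(x, y) \<in> Q \<inter> code ` configs \<times> code ` configs" using fk xy by blast
  next
    fix x y assume xy: "(x, y) \<in> Q \<inter> code ` configs \<times> code ` configs"
    then obtain i j where "(x @ blank i, y @ blank j) \<in> move_along \<sigma>"
      unfolding Q_def by auto
    then obtain ws \<kappa> where ws: "x @ blank i = tape ws \<kappa>" "y @ blank j = tape ws (\<sigma> \<kappa>)"
      "\<kappa> < length ws" "\<sigma> \<kappa> < length ws"
      unfolding move_along_def by blast
    obtain f k g l where f: "x = code (f, k)" "(f, k) \<in> configs" and g: "y = code (g, l)" "(g, l) \<in> configs"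
      using xy by auto
    have *: "pad ws = h \<and> k = m"
      if "code (h, m) @ blank n = tape ws k" "k < length ws" "(h, m) \<in> configs" for h m n k
    proof -
      have fin: "finite {i. h i \<noteq> e}" using that(3) by (simp add: configs_def)
      let ?vs = "map h [0..<extent h m]"
      have m: "m < length ?vs" using extent(1)[OF fin] by simp
      then have "tape (?vs @ replicate n e) m = tape ws k"
        using that(1) by (simp add: code_def blank_def tape_append)
      then have "?vs @ replicate n e = ws \<and> m = k"
        using tape_eq_iff[of m "?vs @ replicate n e" k ws] m that(2) by auto
      moreover have "pad (?vs @ replicate n e) = h"
        by (rule pad_map_replicate) (erule extent(2)[OF fin])
      ultimately show ?thesis by metis
    qed
    have "pad ws = f \<and> \<kappa> = k" by (rule *[of f k i]) (use ws f in simp_all)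
    moreover have "pad ws = g \<and> \<sigma> \<kappa> = l" by (rule *[of g l j]) (use ws g in simp_all)
    ultimately show "(x, y) \<in> ?S" using f g by auto
  qed
  moreover have "sync_regular tape_alphabet (Q \<inter> code ` configs \<times> code ` configs)"
    unfolding Q_def
    by (intro sync_regular_restrict codes_regular sync_regular_UN finite_tape_alphabet)
      (auto intro!: sync_regular_drop_suffix move_along_regular[of b \<sigma> D, OF per D])
  moreover have "lag_bounded (c * Suc (length e)) (Q \<inter> code ` configs \<times> code ` configs)"
  proof -
    have "length x \<le> length y + c * Suc (length e) \<and> length y \<le> length x + c * Suc (length e)"
      if xy: "(x, y) \<in> Q" for x y
    proof -
      obtain i j where ij: "i \<le> c" "j \<le> c" "(x @ blank i, y @ blank j) \<in> move_along \<sigma>"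
        using xy unfolding Q_def by auto
      from ij(3) have "length (x @ blank i) = length (y @ blank j)"
        unfolding move_along_def by (auto simp: length_tape simp del: length_append)
      moreover have "length (blank i) \<le> c * Suc (length e)" if "i \<le> c" for i
        unfolding blank_def length_lamps_replicate using that by (rule mult_le_mono1)
      then have "length (blank i) \<le> c * Suc (length e)" "length (blank j) \<le> c * Suc (length e)"
        using ij(1,2) by blast+
      ultimately show ?thesis unfolding length_append by linarith
    qed
    then show ?thesis unfolding lag_bounded_def by blast
  qed
  ultimately show ?thesis using regular_relation_if_sync_regular by simp
qed

end

section \<open>Enumeration of a virtually infinite cyclic group\<close>

text \<open>The set \<open>\<int> \<times> {..<d}\<close> is enumerated in blocks of length \<open>2 * d\<close>: the block with number \<open>q\<close> holds the
  pairs with first component \<open>q\<close>, followed by those with first component \<open>- 1 - q\<close>.\<close>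

definition fold_index :: "nat \<Rightarrow> int \<times> nat \<Rightarrow> nat" where
  "fold_index d = (\<lambda>(n, j). if n \<ge> 0 then nat n * (2 * d) + j else nat (- 1 - n) * (2 * d) + d + j)"

definition unfold_index :: "nat \<Rightarrow> nat \<Rightarrow> int \<times> nat" where
  "unfold_index d k = (if k mod (2 * d) < d then (int (k div (2 * d)), k mod (2 * d))
     else (- 1 - int (k div (2 * d)), k mod (2 * d) - d))"

lemma unfold_fold_index:
  assumes "j < d"
  shows "unfold_index d (fold_index d (n, j)) = (n, j)"
proof -
  have "(q * (2 * d) + s) div (2 * d) = q" "(q * (2 * d) + s) mod (2 * d) = s" if "s < 2 * d" for q s
    using that by auto
  from this[of j] this[of "d + j"] show ?thesis
    using assms by (auto simp: unfold_index_def fold_index_def add.assoc)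
qed

lemma fold_unfold_index: "d > 0 \<Longrightarrow> fold_index d (unfold_index d k) = k"
  using div_mult_mod_eq[of k "2 * d"] by (auto simp: unfold_index_def fold_index_def)

lemma unfold_index_less:
  assumes "d > 0"
  shows "snd (unfold_index d k) < d"
proof -
  have "k mod (2 * d) < 2 * d" using assms by simp
  then show ?thesis unfolding unfold_index_def by (cases "k mod (2 * d) < d") auto
qed

lemma bij_unfold_index:
  assumes "d > 0"
  shows "bij_betw (unfold_index d) UNIV (UNIV \<times> {..<d})"
proof (rule bij_betw_byWitness[where f' = "fold_index d"])
  show "\<forall>k\<in>UNIV. fold_index d (unfold_index d k) = k" using fold_unfold_index[OF assms] by blast
  show "\<forall>p\<in>UNIV \<times> {..<d}. unfold_index d (fold_index d p) = p" using unfold_fold_index by auto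
  show "unfold_index d ` UNIV \<subseteq> UNIV \<times> {..<d}"
    using unfold_index_less[OF assms] by (intro image_subsetI) (simp add: mem_Times_iff)
qed simp

lemma unfold_index_shift:
  assumes "d > 0"
  shows "unfold_index d (k + 2 * d) =
    (let (n, j) = unfold_index d k in (if n \<ge> 0 then n + 1 else n - 1, j))"
  using assms by (auto simp: unfold_index_def Let_def)

lemma fold_index_shift:
  "n \<ge> 0 \<Longrightarrow> fold_index d (n + 1, j) = fold_index d (n, j) + 2 * d"
  "n < 0 \<Longrightarrow> fold_index d (n - 1, j) = fold_index d (n, j) + 2 * d"
proof -
  assume "n < 0"
  then have "nat (- 1 - (n - 1)) = Suc (nat (- 1 - n))" by simp
  then show "fold_index d (n - 1, j) = fold_index d (n, j) + 2 * d"
    using \<open>n < 0\<close> by (simp add: fold_index_def)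
qed (simp add: fold_index_def nat_add_distrib)

text \<open>From this index on, a translation of the first component by at most \<open>b\<close> preserves its sign, that
  is, it does not cross the fold.\<close>

lemma unfold_index_large:
  assumes "k \<ge> 2 * d * Suc b" "d > 0"
  shows "\<bar>fst (unfold_index d k)\<bar> > int b"
proof -
  have "Suc b \<le> k div (2 * d)" using assms by (simp add: less_eq_div_iff_mult_less_eq mult.commute)
  then show ?thesis by (auto simp: unfold_index_def)
qed

text \<open>Here \<open>\<zeta>\<close> parametrises the infinite cyclic subgroup, and \<open>r\<close> chooses a representative of each of its
  right cosets.\<close>

lemma virtually_infinite_cyclic_coordinates:
  fixes H :: "('b, 'n) monoid_scheme"
  assumes "virtually_infinite_cyclic H"
  obtains \<zeta> :: "int \<Rightarrow> 'b" and r :: "nat \<Rightarrow> 'b" and d :: nat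
  where "d > 0" "bij_betw (\<lambda>(n, j). \<zeta> n \<otimes>\<^bsub>H\<^esub> r j) (UNIV \<times> {..<d}) (carrier H)"
    and "\<And>n. \<zeta> n \<in> carrier H" "\<And>j. j < d \<Longrightarrow> r j \<in> carrier H"
    and "\<And>m n. \<zeta> (m + n) = \<zeta> m \<otimes>\<^bsub>H\<^esub> \<zeta> n"
proof -
  interpret group H using assms unfolding virtually_infinite_cyclic_def by blast
  obtain K where K: "subgroup K H" "finite (rcosets\<^bsub>H\<^esub> K)" "H\<lparr>carrier := K\<rparr> \<cong> integer_group"
    using assms unfolding virtually_infinite_cyclic_def by blast
  interpret K: subgroup K H by fact
  obtain \<phi> where \<phi>: "\<phi> \<in> hom (H\<lparr>carrier := K\<rparr>) integer_group" "bij_betw \<phi> K UNIV"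
    using K(3) unfolding is_iso_def iso_def by auto
  define \<zeta> where "\<zeta> = inv_into K \<phi>"
  have \<zeta>: "bij_betw \<zeta> UNIV K" unfolding \<zeta>_def by (rule bij_betw_inv_into[OF \<phi>(2)])
  have \<zeta>K: "\<zeta> n \<in> K" for n using \<zeta> by (auto simp: bij_betw_def)
  have \<phi>\<zeta>: "\<phi> (\<zeta> n) = n" for n using \<phi>(2) by (simp add: \<zeta>_def bij_betw_inv_into_right)
  have \<zeta>\<phi>: "\<zeta> (\<phi> x) = x" if "x \<in> K" for x using \<phi>(2) that by (simp add: \<zeta>_def bij_betw_inv_into_left)
  have add: "\<zeta> (m + n) = \<zeta> m \<otimes>\<^bsub>H\<^esub> \<zeta> n" for m n
  proof -
    have "\<phi> (\<zeta> m \<otimes>\<^bsub>H\<^esub> \<zeta> n) = m + n"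
      using \<phi>(1) \<zeta>K by (auto simp: hom_def \<phi>\<zeta>)
    then show ?thesis using \<zeta>\<phi>[of "\<zeta> m \<otimes>\<^bsub>H\<^esub> \<zeta> n"] \<zeta>K by simp
  qed
  obtain E where E: "bij_betw E {0..<card (rcosets\<^bsub>H\<^esub> K)} (rcosets\<^bsub>H\<^esub> K)"
    using ex_bij_betw_nat_finite[OF K(2)] by blast
  define d where "d = card (rcosets\<^bsub>H\<^esub> K)"
  define r where "r j = (SOME x. x \<in> E j)" for j
  have EK: "E j \<in> rcosets\<^bsub>H\<^esub> K" if "j < d" for j
    using E that by (auto simp: bij_betw_def d_def)
  have rE: "r j \<in> E j" if j: "j < d" for j
  proof -
    obtain x where "x \<in> carrier H" "E j = K #>\<^bsub>H\<^esub> x"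
      using EK[OF j] unfolding RCOSETS_def by blast
    then have "x \<in> E j" using rcos_self[OF _ K(1)] by simp
    then show ?thesis unfolding r_def by (rule someI)
  qed
  have rH: "r j \<in> carrier H" if "j < d" for j
    using K.rcosets_carrier[OF is_group EK[OF that]] rE[OF that] by blast
  have Er: "E j = K #>\<^bsub>H\<^esub> r j" if j: "j < d" for j
  proof -
    obtain x where "x \<in> carrier H" "E j = K #>\<^bsub>H\<^esub> x"
      using EK[OF j] unfolding RCOSETS_def by blast
    then show ?thesis using repr_independence[of "r j" K x] rE[OF j] K(1) by simp
  qed
  have "bij_betw (\<lambda>(n, j). \<zeta> n \<otimes>\<^bsub>H\<^esub> r j) (UNIV \<times> {..<d}) (carrier H)"
  proof (rule bij_betw_imageI)
    show "inj_on (\<lambda>(n, j). \<zeta> n \<otimes>\<^bsub>H\<^esub> r j) (UNIV \<times> {..<d})"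
    proof (rule inj_onI, clarify)
      fix n j m i assume ji: "j < d" "i < d" and eq: "\<zeta> n \<otimes>\<^bsub>H\<^esub> r j = \<zeta> m \<otimes>\<^bsub>H\<^esub> r i"
      have mem: "\<zeta> n \<otimes>\<^bsub>H\<^esub> r j \<in> K #>\<^bsub>H\<^esub> r j" if "j < d" for n j
        using \<zeta>K unfolding r_coset_def by blast
      have "K #>\<^bsub>H\<^esub> r j = K #>\<^bsub>H\<^esub> (\<zeta> n \<otimes>\<^bsub>H\<^esub> r j)"
        using mem[OF ji(1)] rH[OF ji(1)] K(1) by (rule repr_independence)
      also have "\<dots> = K #>\<^bsub>H\<^esub> r i"
        unfolding eq using mem[OF ji(2)] rH[OF ji(2)] K(1) by (rule repr_independence[symmetric])
      finally have "E j = E i" using ji Er by simp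
      then have "j = i" using E ji unfolding bij_betw_def d_def by (auto dest: inj_onD)
      then have "\<zeta> n = \<zeta> m" using eq rH[OF ji(1)] \<zeta>K K.mem_carrier by simp
      then show "n = m \<and> j = i" using \<open>j = i\<close> \<phi>\<zeta> by metis
    qed
    show "(\<lambda>(n, j). \<zeta> n \<otimes>\<^bsub>H\<^esub> r j) ` (UNIV \<times> {..<d}) = carrier H"
    proof (intro equalityI subsetI)
      fix h assume h: "h \<in> carrier H"
      have "K #>\<^bsub>H\<^esub> h \<in> rcosets\<^bsub>H\<^esub> K" by (rule rcosetsI[OF K.subset h])
      then obtain j where j: "j < d" "E j = K #>\<^bsub>H\<^esub> h"
        using E unfolding bij_betw_def d_def by (metis atLeastLessThan_iff imageE)
      then have "h \<in> K #>\<^bsub>H\<^esub> r j" using Er rcos_self[OF h K(1)] by simp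
      then obtain x where "x \<in> K" "h = x \<otimes>\<^bsub>H\<^esub> r j" unfolding r_coset_def by blast
      then show "h \<in> (\<lambda>(n, j). \<zeta> n \<otimes>\<^bsub>H\<^esub> r j) ` (UNIV \<times> {..<d})"
        using j(1) \<zeta>\<phi> by (intro image_eqI[of _ _ "(\<phi> x, j)"]) simp_all
    qed (use rH \<zeta>K K.mem_carrier in auto)
  qed
  moreover have "d > 0"
  proof -
    have "K #>\<^bsub>H\<^esub> \<one>\<^bsub>H\<^esub> \<in> rcosets\<^bsub>H\<^esub> K" by (rule rcosetsI[OF K.subset one_closed])
    then show ?thesis unfolding d_def using K(2) card_gt_0_iff by blast
  qed
  ultimately show thesis by (intro that[of d \<zeta> r] K.mem_carrier \<zeta>K rH add)
qed

text \<open>If \<open>r j \<cdot> t = \<zeta> (m j) \<cdot> r (p j)\<close>, then \<open>\<zeta> n \<cdot> r j \<cdot> t = \<zeta> (n + m j) \<cdot> r (p j)\<close>. The effect of \<open>t\<close> on the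
  coordinates is therefore invariant under translation of \<open>n\<close>, and on the folded indices this
  invariance persists away from the fold.\<close>

lemma virtually_infinite_cyclic_enumeration:
  fixes H :: "('b, 'n) monoid_scheme"
  assumes H: "virtually_infinite_cyclic H"
  obtains \<rho> :: "nat \<Rightarrow> 'b" and D :: nat and T :: "'b set"
  where "bij_betw \<rho> UNIV (carrier H)" "D > 0"
    and "\<And>t. t \<in> carrier H \<Longrightarrow> \<exists>\<sigma> b. (\<forall>k. \<rho> k \<otimes>\<^bsub>H\<^esub> t = \<rho> (\<sigma> k)) \<and> (\<forall>k\<ge>b. \<sigma> (k + D) = \<sigma> k + D)"
    and "finite T" "T \<subseteq> carrier H" "m_inv H ` T = T" "generate H T = carrier H"
proof -
  interpret group H using assms unfolding virtually_infinite_cyclic_def by blast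
  obtain \<zeta> :: "int \<Rightarrow> 'b" and r :: "nat \<Rightarrow> 'b" and d :: nat where d: "d > 0"
    and bij: "bij_betw (\<lambda>(n, j). \<zeta> n \<otimes>\<^bsub>H\<^esub> r j) (UNIV \<times> {..<d}) (carrier H)"
    and \<zeta>: "\<And>n. \<zeta> n \<in> carrier H" and r: "\<And>j. j < d \<Longrightarrow> r j \<in> carrier H"
    and add: "\<And>m n. \<zeta> (m + n) = \<zeta> m \<otimes>\<^bsub>H\<^esub> \<zeta> n"
    by (rule virtually_infinite_cyclic_coordinates[OF H]) (rule that)
  define \<rho> where "\<rho> = (\<lambda>(n, j). \<zeta> n \<otimes>\<^bsub>H\<^esub> r j) \<circ> unfold_index d"
  have surj: "\<exists>n j. j < d \<and> h = \<zeta> n \<otimes>\<^bsub>H\<^esub> r j" if "h \<in> carrier H" for h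
  proof -
    have "h \<in> (\<lambda>(n, j). \<zeta> n \<otimes>\<^bsub>H\<^esub> r j) ` (UNIV \<times> {..<d})"
      using bij that by (simp add: bij_betw_def)
    then show ?thesis by auto
  qed
  have \<rho>: "bij_betw \<rho> UNIV (carrier H)"
    unfolding \<rho>_def by (rule bij_betw_trans[OF bij_unfold_index[OF d] bij])
  have \<rho>_fold: "\<rho> (fold_index d (n, j)) = \<zeta> n \<otimes>\<^bsub>H\<^esub> r j" if "j < d" for n j
    by (simp add: \<rho>_def unfold_fold_index[OF that])
  have periodic: "\<exists>\<sigma> b. (\<forall>k. \<rho> k \<otimes>\<^bsub>H\<^esub> t = \<rho> (\<sigma> k)) \<and> (\<forall>k\<ge>b. \<sigma> (k + 2 * d) = \<sigma> k + 2 * d)"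
    if t: "t \<in> carrier H" for t
  proof -
    have choice: "\<forall>j\<in>{..<d}. \<exists>m i. i < d \<and> r j \<otimes>\<^bsub>H\<^esub> t = \<zeta> m \<otimes>\<^bsub>H\<^esub> r i"
    proof
      fix j assume "j \<in> {..<d}"
      then have "r j \<otimes>\<^bsub>H\<^esub> t \<in> carrier H" using r t by simp
      then show "\<exists>m i. i < d \<and> r j \<otimes>\<^bsub>H\<^esub> t = \<zeta> m \<otimes>\<^bsub>H\<^esub> r i" by (rule surj)
    qed
    obtain m where m: "\<forall>j\<in>{..<d}. \<exists>i. i < d \<and> r j \<otimes>\<^bsub>H\<^esub> t = \<zeta> (m j) \<otimes>\<^bsub>H\<^esub> r i"
      using bchoice[OF choice] ..
    obtain p where "\<forall>j\<in>{..<d}. p j < d \<and> r j \<otimes>\<^bsub>H\<^esub> t = \<zeta> (m j) \<otimes>\<^bsub>H\<^esub> r (p j)"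
      using bchoice[OF m] ..
    then have mp: "\<And>j. j < d \<Longrightarrow> p j < d"
      "\<And>j. j < d \<Longrightarrow> r j \<otimes>\<^bsub>H\<^esub> t = \<zeta> (m j) \<otimes>\<^bsub>H\<^esub> r (p j)"
      by simp_all
    define \<sigma> where "\<sigma> k = (let (n, j) = unfold_index d k in fold_index d (n + m j, p j))" for k
    have "\<rho> k \<otimes>\<^bsub>H\<^esub> t = \<rho> (\<sigma> k)" for k
    proof -
      obtain n j where nj: "unfold_index d k = (n, j)" by (cases "unfold_index d k")
      then have j: "j < d" using unfold_index_less[OF d, of k] by simp
      have "\<rho> k \<otimes>\<^bsub>H\<^esub> t = \<zeta> n \<otimes>\<^bsub>H\<^esub> (r j \<otimes>\<^bsub>H\<^esub> t)"
        using nj j t r \<zeta> by (simp add: \<rho>_def m_assoc)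
      also have "\<dots> = \<zeta> (n + m j) \<otimes>\<^bsub>H\<^esub> r (p j)"
        using j r \<zeta> mp by (simp add: add m_assoc)
      also have "\<dots> = \<rho> (\<sigma> k)" using nj mp(1)[OF j] by (simp add: \<sigma>_def \<rho>_fold)
      finally show ?thesis .
    qed
    moreover define b where "b = nat (Max ((\<lambda>j. \<bar>m j\<bar>) ` {..<d}))"
    have b: "\<bar>m j\<bar> \<le> int b" if "j < d" for j
    proof -
      have "\<bar>m j\<bar> \<le> Max ((\<lambda>j. \<bar>m j\<bar>) ` {..<d})" by (rule Max_ge) (use that in auto)
      then show ?thesis unfolding b_def by linarith
    qed
    have "\<sigma> (k + 2 * d) = \<sigma> k + 2 * d" if k: "k \<ge> 2 * d * Suc b" for k
    proof -
      obtain n j where nj: "unfold_index d k = (n, j)" by (cases "unfold_index d k")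
      then have j: "j < d" using unfold_index_less[OF d, of k] by simp
      have big: "\<bar>n\<bar> > int b" using unfold_index_large[OF k d] nj by simp
      show ?thesis
      proof (cases "n \<ge> 0")
        case True
        then have "n + m j \<ge> 0" using big b[OF j] by linarith
        moreover have eq: "n + 1 + m j = n + m j + 1" by simp
        ultimately show ?thesis
          using fold_index_shift(1)[of "n + m j" d "p j"] True nj
          by (simp add: \<sigma>_def unfold_index_shift[OF d] eq)
      next
        case False
        then have "n + m j < 0" using big b[OF j] by linarith
        moreover have eq: "n - 1 + m j = n + m j - 1" by simp
        ultimately show ?thesis
          using fold_index_shift(2)[of "n + m j" d "p j"] False nj
          by (simp add: \<sigma>_def unfold_index_shift[OF d] eq)
      qed
    qed
    ultimately show ?thesis by blast
  qed
  define T0 where "T0 = insert (\<zeta> 1) (r ` {..<d})"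
  define T where "T = T0 \<union> m_inv H ` T0"
  have T0: "T0 \<subseteq> carrier H" using \<zeta> r by (auto simp: T0_def)
  then have T: "T \<subseteq> carrier H" by (auto simp: T_def)
  have "m_inv H ` m_inv H ` T0 = T0" using T0 by (force simp: image_image)
  then have "m_inv H ` T = T" unfolding T_def by (simp add: image_Un Un_commute)
  moreover have "generate H T = carrier H"
  proof
    show "generate H T \<subseteq> carrier H" by (rule generate_incl[OF T])
    have zero: "\<zeta> 0 = \<one>\<^bsub>H\<^esub>" using add[of 0 0] \<zeta>[of 0] by (simp add: l_cancel_one')
    have "\<zeta> (- 1) = inv\<^bsub>H\<^esub> (\<zeta> 1)"
      using add[of "- 1" 1] \<zeta> by (simp add: zero inv_equality)
    then have gen1: "\<zeta> 1 \<in> generate H T" "\<zeta> (- 1) \<in> generate H T"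
      by (auto simp: T_def T0_def intro: generate.incl)
    have gen\<zeta>: "\<zeta> n \<in> generate H T" for n
    proof (induction n rule: int_induct[of _ 0])
      case base
      show ?case unfolding zero by (rule generate.one)
    next
      case (step1 i)
      then show ?case using add[of i 1] gen1 by (simp add: generate.eng)
    next
      case (step2 i)
      then show ?case using add[of i "- 1"] gen1 by (simp add: generate.eng)
    qed
    show "carrier H \<subseteq> generate H T"
    proof
      fix h assume "h \<in> carrier H"
      then obtain n j where "j < d" "h = \<zeta> n \<otimes>\<^bsub>H\<^esub> r j" using surj by blast
      moreover from this have "r j \<in> generate H T"
        by (intro generate.incl) (auto simp: T_def T0_def)
      ultimately show "h \<in> generate H T" using gen\<zeta> by (simp add: generate.eng)
    qed
  qed
  moreover have "finite T" by (simp add: T_def T0_def)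
  moreover have "2 * d > 0" using d by simp
  ultimately show thesis using that[of \<rho> "2 * d" T] \<rho> periodic T by blast
qed

section \<open>Generators of the wreath product\<close>

locale wreath = G: group G + H: group H
  for G :: "('a, 'm) monoid_scheme" (structure) and H :: "('b, 'n) monoid_scheme" (structure)
begin

abbreviation "W \<equiv> restricted_wreath G H"

definition lamp :: "'a \<Rightarrow> ('b \<Rightarrow> 'a) \<times> 'b" where
  "lamp a = ((\<lambda>x\<in>carrier H. if x = \<one>\<^bsub>H\<^esub> then a else \<one>\<^bsub>G\<^esub>), \<one>\<^bsub>H\<^esub>)"

definition walk :: "'b \<Rightarrow> ('b \<Rightarrow> 'a) \<times> 'b" where
  "walk t = ((\<lambda>x\<in>carrier H. \<one>\<^bsub>G\<^esub>), t)"

lemma W_group: "group W"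
  by (rule group_restricted_wreath) (rule G.is_group H.is_group)+

lemma carrier_W: "(\<gamma>, h) \<in> carrier W \<longleftrightarrow>
    \<gamma> \<in> carrier H \<rightarrow>\<^sub>E carrier G \<and> finite {x \<in> carrier H. \<gamma> x \<noteq> \<one>\<^bsub>G\<^esub>} \<and> h \<in> carrier H"
  by (simp add: restricted_wreath_def carrier_fin_supp_group[OF G.is_group])

lemma mult_W: "(\<gamma>, h) \<otimes>\<^bsub>W\<^esub> (\<gamma>', h') =
    ((\<lambda>x\<in>carrier H. \<gamma> x \<otimes>\<^bsub>G\<^esub> shift H (inv\<^bsub>H\<^esub> h) \<gamma>' x), h \<otimes>\<^bsub>H\<^esub> h')"
  by (simp add: restricted_wreath_def fin_supp_group_def)

lemma lamp_in_W: "a \<in> carrier G \<Longrightarrow> lamp a \<in> carrier W"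
  unfolding lamp_def carrier_W by (auto intro: finite_subset[of _ "{\<one>\<^bsub>H\<^esub>}"])

lemma walk_in_W: "t \<in> carrier H \<Longrightarrow> walk t \<in> carrier W"
  unfolding walk_def carrier_W by auto

text \<open>The action of \<open>h\<close> in the multiplication carries the support of \<open>lamp a\<close> from \<open>1\<close> to the position \<open>h\<close> of
  the lamplighter.\<close>

lemma mult_lamp:
  assumes "(\<gamma>, h) \<in> carrier W" "a \<in> carrier G"
  shows "(\<gamma>, h) \<otimes>\<^bsub>W\<^esub> lamp a = (\<gamma>(h := \<gamma> h \<otimes>\<^bsub>G\<^esub> a), h)"
proof -
  have \<gamma>: "\<gamma> \<in> carrier H \<rightarrow>\<^sub>E carrier G" and h: "h \<in> carrier H"
    using assms by (simp_all add: carrier_W)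
  have eq: "inv\<^bsub>H\<^esub> h \<otimes>\<^bsub>H\<^esub> x = \<one>\<^bsub>H\<^esub> \<longleftrightarrow> x = h" if "x \<in> carrier H" for x
    using h that by (metis H.inv_closed H.inv_solve_left H.r_one H.one_closed)
  have "(\<lambda>x\<in>carrier H. \<gamma> x \<otimes>\<^bsub>G\<^esub> shift H (inv\<^bsub>H\<^esub> h)
      (\<lambda>x\<in>carrier H. if x = \<one>\<^bsub>H\<^esub> then a else \<one>\<^bsub>G\<^esub>) x) = \<gamma>(h := \<gamma> h \<otimes>\<^bsub>G\<^esub> a)"
  proof
    fix x
    show "(\<lambda>x\<in>carrier H. \<gamma> x \<otimes>\<^bsub>G\<^esub> shift H (inv\<^bsub>H\<^esub> h)
      (\<lambda>x\<in>carrier H. if x = \<one>\<^bsub>H\<^esub> then a else \<one>\<^bsub>G\<^esub>) x) x = (\<gamma>(h := \<gamma> h \<otimes>\<^bsub>G\<^esub> a)) x"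
    proof (cases "x \<in> carrier H")
      case True
      then have "\<gamma> x \<in> carrier G" using \<gamma> by blast
      then show ?thesis using True h eq[OF True] by (simp add: shift_def)
    next
      case False
      then show ?thesis using \<gamma> h by (auto simp: PiE_def extensional_def)
    qed
  qed
  then show ?thesis using h by (simp add: lamp_def mult_W)
qed

lemma mult_walk:
  assumes "(\<gamma>, h) \<in> carrier W" "t \<in> carrier H"
  shows "(\<gamma>, h) \<otimes>\<^bsub>W\<^esub> walk t = (\<gamma>, h \<otimes>\<^bsub>H\<^esub> t)"
proof -
  have \<gamma>: "\<gamma> \<in> carrier H \<rightarrow>\<^sub>E carrier G" and h: "h \<in> carrier H"
    using assms by (simp_all add: carrier_W)
  have "(\<lambda>x\<in>carrier H. \<gamma> x \<otimes>\<^bsub>G\<^esub> shift H (inv\<^bsub>H\<^esub> h) (\<lambda>x\<in>carrier H. \<one>\<^bsub>G\<^esub>) x) = \<gamma>"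
  proof
    fix x
    show "(\<lambda>x\<in>carrier H. \<gamma> x \<otimes>\<^bsub>G\<^esub> shift H (inv\<^bsub>H\<^esub> h) (\<lambda>x\<in>carrier H. \<one>\<^bsub>G\<^esub>) x) x = \<gamma> x"
    proof (cases "x \<in> carrier H")
      case True
      then have "\<gamma> x \<in> carrier G" using \<gamma> by blast
      then show ?thesis using True h by (simp add: shift_def)
    next
      case False
      then show ?thesis using \<gamma> by (auto simp: PiE_def extensional_def)
    qed
  qed
  then show ?thesis by (simp add: walk_def mult_W)
qed

lemma lamp_hom: "lamp \<in> hom G W"
proof (rule homI)
  fix a b assume ab: "a \<in> carrier G" "b \<in> carrier G"
  have "lamp a \<otimes>\<^bsub>W\<^esub> lamp b = ((fst (lamp a))(\<one>\<^bsub>H\<^esub> := fst (lamp a) \<one>\<^bsub>H\<^esub> \<otimes>\<^bsub>G\<^esub> b), \<one>\<^bsub>H\<^esub>)"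
    using mult_lamp[of "fst (lamp a)" "\<one>\<^bsub>H\<^esub>" b] lamp_in_W[OF ab(1)] ab(2) by (simp add: lamp_def)
  also have "\<dots> = lamp (a \<otimes>\<^bsub>G\<^esub> b)" by (auto simp: lamp_def fun_eq_iff)
  finally show "lamp (a \<otimes>\<^bsub>G\<^esub> b) = lamp a \<otimes>\<^bsub>W\<^esub> lamp b" ..
qed (rule lamp_in_W)

lemma walk_hom: "walk \<in> hom H W"
proof (rule homI)
  fix s t assume st: "s \<in> carrier H" "t \<in> carrier H"
  show "walk (s \<otimes>\<^bsub>H\<^esub> t) = walk s \<otimes>\<^bsub>W\<^esub> walk t"
    using mult_walk[of "fst (walk s)" s t] walk_in_W[OF st(1)] st(2) by (simp add: walk_def)
qed (rule walk_in_W)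

text \<open>By induction on the support: to reach \<open>(\<gamma>, h)\<close>, the lamps other than one at \<open>x\<close> are set first and
  the lamplighter is left at \<open>x\<close>; then the lamp at \<open>x\<close> is set and the lamplighter walks to \<open>h\<close>.\<close>

lemma generate_W:
  assumes S: "S \<subseteq> carrier G" "generate G S = carrier G" and T: "T \<subseteq> carrier H" "generate H T = carrier H"
  shows "generate W (lamp ` S \<union> walk ` T) = carrier W"
proof
  interpret W: group W by (rule W_group)
  interpret lamp: group_hom G W lamp using lamp_hom by unfold_locales
  interpret walk: group_hom H W walk using walk_hom by unfold_locales
  let ?gen = "generate W (lamp ` S \<union> walk ` T)"
  show "?gen \<subseteq> carrier W"
    by (rule W.generate_incl) (use S T lamp_in_W walk_in_W in blast)
  have "generate W (lamp ` S) \<subseteq> ?gen" "generate W (walk ` T) \<subseteq> ?gen"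
    by (rule W.mono_generate, simp)+
  then have gen: "lamp a \<in> ?gen" "walk t \<in> ?gen" if "a \<in> carrier G" "t \<in> carrier H" for a t
    using lamp.generate_img[OF S(1)] walk.generate_img[OF T(1)] S T that by auto
  have "\<forall>\<gamma> h. (\<gamma>, h) \<in> carrier W \<longrightarrow> {x \<in> carrier H. \<gamma> x \<noteq> \<one>\<^bsub>G\<^esub>} \<subseteq> A \<longrightarrow> (\<gamma>, h) \<in> ?gen"
    if "finite A" for A
    using that
  proof induction
    case empty
    show ?case
    proof (intro allI impI)
      fix \<gamma> h assume \<gamma>: "(\<gamma>, h) \<in> carrier W" "{x \<in> carrier H. \<gamma> x \<noteq> \<one>\<^bsub>G\<^esub>} \<subseteq> {}"
      have "\<gamma> = (\<lambda>x\<in>carrier H. \<one>\<^bsub>G\<^esub>)"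
      proof
        fix x show "\<gamma> x = (\<lambda>x\<in>carrier H. \<one>\<^bsub>G\<^esub>) x"
          using \<gamma> by (cases "x \<in> carrier H") (auto simp: carrier_W PiE_def extensional_def)
      qed
      then have "(\<gamma>, h) = walk h" by (simp add: walk_def)
      moreover have "h \<in> carrier H" using \<gamma>(1) by (simp add: carrier_W)
      ultimately show "(\<gamma>, h) \<in> ?gen" using gen(2)[OF G.one_closed] by simp
    qed
  next
    case (insert x A)
    show ?case
    proof (intro allI impI)
      fix \<gamma> h assume \<gamma>: "(\<gamma>, h) \<in> carrier W" "{x \<in> carrier H. \<gamma> x \<noteq> \<one>\<^bsub>G\<^esub>} \<subseteq> insert x A"
      show "(\<gamma>, h) \<in> ?gen"
      proof (cases "x \<in> carrier H")
        case True
        have h: "h \<in> carrier H" and \<gamma>x: "\<gamma> x \<in> carrier G" using \<gamma>(1) True by (auto simp: carrier_W)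
        define \<gamma>' where "\<gamma>' = \<gamma>(x := \<one>\<^bsub>G\<^esub>)"
        have "{y \<in> carrier H. \<gamma>' y \<noteq> \<one>\<^bsub>G\<^esub>} \<subseteq> {y \<in> carrier H. \<gamma> y \<noteq> \<one>\<^bsub>G\<^esub>}"
          by (auto simp: \<gamma>'_def)
        then have "finite {y \<in> carrier H. \<gamma>' y \<noteq> \<one>\<^bsub>G\<^esub>}"
          by (rule finite_subset) (use \<gamma>(1) in \<open>simp add: carrier_W\<close>)
        moreover have "\<gamma>' \<in> carrier H \<rightarrow>\<^sub>E carrier G"
          using \<gamma>(1) True by (auto simp: carrier_W \<gamma>'_def PiE_def extensional_def)
        ultimately have \<gamma>': "(\<gamma>', x) \<in> carrier W" using True by (simp add: carrier_W)
        moreover have "{y \<in> carrier H. \<gamma>' y \<noteq> \<one>\<^bsub>G\<^esub>} \<subseteq> A"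
          using \<gamma>(2) by (auto simp: \<gamma>'_def)
        ultimately have "(\<gamma>', x) \<in> ?gen" using insert.IH by blast
        then have "(\<gamma>', x) \<otimes>\<^bsub>W\<^esub> lamp (\<gamma> x) \<in> ?gen"
          using gen(1)[OF \<gamma>x h] by (rule generate.eng)
        then have "(\<gamma>, x) \<in> ?gen"
          using mult_lamp[OF \<gamma>' \<gamma>x] \<gamma>x by (simp add: \<gamma>'_def)
        then have "(\<gamma>, x) \<otimes>\<^bsub>W\<^esub> walk (inv\<^bsub>H\<^esub> x \<otimes>\<^bsub>H\<^esub> h) \<in> ?gen"
          using gen(2)[OF \<gamma>x, of "inv\<^bsub>H\<^esub> x \<otimes>\<^bsub>H\<^esub> h"] True h by (intro generate.eng) simp_all
        moreover have "(\<gamma>, x) \<in> carrier W" using \<gamma>(1) True by (simp add: carrier_W)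
        ultimately show ?thesis
          using mult_walk[of \<gamma> x "inv\<^bsub>H\<^esub> x \<otimes>\<^bsub>H\<^esub> h"] True h by (simp flip: H.m_assoc)
      next
        case False
        then have "{x \<in> carrier H. \<gamma> x \<noteq> \<one>\<^bsub>G\<^esub>} \<subseteq> A" using \<gamma>(2) by auto
        then show ?thesis using insert.IH \<gamma>(1) by blast
      qed
    qed
  qed
  then show "carrier W \<subseteq> ?gen" by (auto simp: carrier_W)
qed

end

section \<open>The Cayley automatic structure\<close>

text \<open>The relation is the graph of right multiplication by \<open>a\<close>, and its converse is the relation of the
  inverse of \<open>a\<close>, which is also a generator. So both are regular and functional.\<close>

lemma cayley_automatic_relation:
  assumes G: "group G" and struct: "cayley_automatic_structure G S \<Lambda> L \<psi>" and a: "a \<in> S"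
  defines "R \<equiv> {(u, v). u \<in> L \<and> v \<in> L \<and> \<psi> u \<otimes>\<^bsub>G\<^esub> a = \<psi> v}"
  shows "sync_regular \<Lambda> R" "\<exists>c. lag_bounded c R"
proof -
  interpret group G by fact
  have S: "S \<subseteq> carrier G" "m_inv G ` S = S" and \<psi>: "bij_betw \<psi> L (carrier G)"
    and regular: "\<And>a. a \<in> S \<Longrightarrow> regular_relation \<Lambda> {(u, v). u \<in> L \<and> v \<in> L \<and> \<psi> u \<otimes>\<^bsub>G\<^esub> a = \<psi> v}"
    using struct unfolding cayley_automatic_structure_def by simp_all
  have aG: "a \<in> carrier G" using a S(1) by blast
  have \<psi>G: "\<psi> u \<in> carrier G" if "u \<in> L" for u using \<psi> that by (auto simp: bij_betw_def)
  have \<psi>_inj: "u = v" if "\<psi> u = \<psi> v" "u \<in> L" "v \<in> L" for u v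
    using \<psi> that by (auto simp: bij_betw_def dest: inj_onD)
  have R: "regular_relation \<Lambda> R" unfolding R_def by (rule regular[OF a])
  then show "sync_regular \<Lambda> R" by (rule sync_regular_if_regular_relation)
  have "inv\<^bsub>G\<^esub> a \<in> S" using a S(2) by blast
  moreover have "R\<inverse> = {(u, v). u \<in> L \<and> v \<in> L \<and> \<psi> u \<otimes>\<^bsub>G\<^esub> inv\<^bsub>G\<^esub> a = \<psi> v}"
  proof (rule Set.set_eqI, clarify)
    fix u v
    have "\<psi> v \<otimes>\<^bsub>G\<^esub> a = \<psi> u \<longleftrightarrow> \<psi> u \<otimes>\<^bsub>G\<^esub> inv\<^bsub>G\<^esub> a = \<psi> v" if "u \<in> L" "v \<in> L"
      using inv_solve_right'[OF \<psi>G[OF that(2)] \<psi>G[OF that(1)] aG] by metis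
    then show "((u, v) \<in> R\<inverse>) = ((u, v) \<in> {(u, v). u \<in> L \<and> v \<in> L \<and> \<psi> u \<otimes>\<^bsub>G\<^esub> inv\<^bsub>G\<^esub> a = \<psi> v})"
      unfolding R_def by auto
  qed
  ultimately have R': "regular_relation \<Lambda> (R\<inverse>)" using regular by simp
  have "single_valued R" unfolding R_def by (auto intro!: single_valuedI \<psi>_inj)
  moreover have "single_valued (R\<inverse>)" unfolding R_def
  proof (intro single_valuedI)
    fix v u u' assume "(v, u) \<in> {(u, v). u \<in> L \<and> v \<in> L \<and> \<psi> u \<otimes>\<^bsub>G\<^esub> a = \<psi> v}\<inverse>"
      "(v, u') \<in> {(u, v). u \<in> L \<and> v \<in> L \<and> \<psi> u \<otimes>\<^bsub>G\<^esub> a = \<psi> v}\<inverse>"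
    then have "u \<in> L" "u' \<in> L" "\<psi> u \<otimes>\<^bsub>G\<^esub> a = \<psi> u' \<otimes>\<^bsub>G\<^esub> a" by auto
    then show "u = u'" using \<psi>G aG by (intro \<psi>_inj) simp_all
  qed
  ultimately show "\<exists>c. lag_bounded c R" by (rule lag_bounded_if_bijective[OF R R'])
qed

theorem theorem3p1:
  fixes G :: "('a, 'm) monoid_scheme" and H :: "('b, 'n) monoid_scheme"
  assumes "cayley_automatic G" and "virtually_infinite_cyclic H"
  shows "cayley_automatic (restricted_wreath G H)"
proof -
  obtain S and \<Lambda> :: "nat set" and L \<psi>
    where G: "group G" and struct: "cayley_automatic_structure G S \<Lambda> L \<psi>"
    using assms(1) unfolding cayley_automatic_def by blast
  have S: "finite S" "S \<subseteq> carrier G" "m_inv G ` S = S" "generate G S = carrier G"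
    and L: "regular_language \<Lambda> L" and \<psi>: "bij_betw \<psi> L (carrier G)"
    using struct unfolding cayley_automatic_structure_def by simp_all
  have H: "group H" using assms(2) unfolding virtually_infinite_cyclic_def by blast
  interpret wreath G H using G H by (rule wreath.intro)
  interpret W: group W by (rule W_group)
  interpret lamp: group_hom G W lamp using lamp_hom by unfold_locales
  interpret walk: group_hom H W walk using walk_hom by unfold_locales
  obtain \<rho> :: "nat \<Rightarrow> 'b" and D T
    where \<rho>: "bij_betw \<rho> UNIV (carrier H)" and D: "D > 0"
    and steps: "\<And>t. t \<in> carrier H \<Longrightarrow>
      \<exists>\<sigma> b. (\<forall>k. \<rho> k \<otimes>\<^bsub>H\<^esub> t = \<rho> (\<sigma> k)) \<and> (\<forall>k\<ge>b. \<sigma> (k + D) = \<sigma> k + D)"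
    and T: "finite T" "T \<subseteq> carrier H" "m_inv H ` T = T" "generate H T = carrier H"
    by (rule virtually_infinite_cyclic_enumeration[OF assms(2)]) (rule that)
  define \<iota> where "\<iota> = inv_into L \<psi>"
  define \<nu> where "\<nu> = inv_into UNIV \<rho>"
  define e where "e = \<iota> \<one>\<^bsub>G\<^esub>"
  have \<iota>: "\<iota> g \<in> L" "\<psi> (\<iota> g) = g" if "g \<in> carrier G" for g
    using \<psi> that by (auto simp: \<iota>_def bij_betw_def inv_into_into f_inv_into_f)
  have \<psi>_inj: "\<psi> u = \<psi> v \<longleftrightarrow> u = v" if "u \<in> L" "v \<in> L" for u v
    using \<psi> that by (auto simp: bij_betw_def dest: inj_onD)
  have \<psi>G: "\<psi> u \<in> carrier G" if "u \<in> L" for u using \<psi> that by (auto simp: bij_betw_def)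
  have \<nu>: "\<nu> (\<rho> k) = k" for k using \<rho> by (simp add: \<nu>_def bij_betw_def)
  have \<rho>\<nu>: "\<rho> (\<nu> h) = h" if "h \<in> carrier H" for h
    using \<rho> that by (simp add: \<nu>_def bij_betw_inv_into_right)
  have \<rho>H: "\<rho> k \<in> carrier H" for k using \<rho> by (auto simp: bij_betw_def)
  have e_one: "e \<in> L" "\<psi> e = \<one>\<^bsub>G\<^esub>" unfolding e_def by (rule \<iota>; simp)+
  interpret lamp_words \<Lambda> L e using L e_one(1) by (rule lamp_words.intro)

  \<comment> \<open>Lamp words and an index of a position describe an element of the wreath product.\<close>
  define \<Phi> where "\<Phi> = (\<lambda>(f, k). ((\<lambda>h\<in>carrier H. \<psi> (f (\<nu> h))), \<rho> k))"
  have supp: "{h \<in> carrier H. \<psi> (f (\<nu> h)) \<noteq> \<one>\<^bsub>G\<^esub>} = \<rho> ` {i. f i \<noteq> e}" if "\<And>i. f i \<in> L" for f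
  proof -
    have "\<psi> (f i) = \<one>\<^bsub>G\<^esub> \<longleftrightarrow> f i = e" for i using \<psi>_inj[OF that e_one(1), of i] e_one(2) by simp
    then show ?thesis using \<rho>H \<nu> \<rho>\<nu> by (force simp: image_iff)
  qed
  have \<Phi>W: "\<Phi> c \<in> carrier W" if "c \<in> configs" for c
  proof -
    obtain f k where c: "c = (f, k)" by (cases c)
    then have f: "\<And>i. f i \<in> L" "finite {i. f i \<noteq> e}" using that by (simp_all add: configs_def)
    have "finite {h \<in> carrier H. (\<lambda>h\<in>carrier H. \<psi> (f (\<nu> h))) h \<noteq> \<one>\<^bsub>G\<^esub>}"
      using supp[of f, OF f(1)] f(2) by (simp cong: conj_cong)
    then show ?thesis unfolding c \<Phi>_def prod.case carrier_W using f(1) \<psi>G \<rho>H by simp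
  qed
  have \<Phi>_bij: "bij_betw \<Phi> configs (carrier W)"
  proof (rule bij_betw_imageI)
    show "inj_on \<Phi> configs"
    proof (rule inj_onI, clarify)
      fix f k g l assume fg: "(f, k) \<in> configs" "(g, l) \<in> configs" and eq: "\<Phi> (f, k) = \<Phi> (g, l)"
      have "\<psi> (f i) = \<psi> (g i)" for i
        using fun_cong[OF arg_cong[OF eq, of fst], of "\<rho> i"] by (simp add: \<Phi>_def \<nu> \<rho>H)
      then have "f i = g i" for i using fg \<psi>_inj by (simp add: configs_def)
      moreover have "k = l" using arg_cong[OF eq, of "\<nu> \<circ> snd"] by (simp add: \<Phi>_def \<nu>)
      ultimately show "f = g \<and> k = l" by blast
    qed
    show "\<Phi> ` configs = carrier W"
    proof (intro equalityI subsetI)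
      fix w assume "w \<in> carrier W"
      then obtain \<gamma> h where w: "w = (\<gamma>, h)" and \<gamma>: "\<gamma> \<in> carrier H \<rightarrow>\<^sub>E carrier G"
        "finite {x \<in> carrier H. \<gamma> x \<noteq> \<one>\<^bsub>G\<^esub>}" "h \<in> carrier H"
        using carrier_W by (cases w) blast
      define f where "f i = \<iota> (\<gamma> (\<rho> i))" for i
      have fL: "f i \<in> L" for i unfolding f_def by (rule \<iota>) (use \<gamma>(1) \<rho>H in blast)
      have \<psi>f: "\<psi> (f (\<nu> x)) = \<gamma> x" if "x \<in> carrier H" for x
        unfolding f_def \<rho>\<nu>[OF that] by (rule \<iota>) (use \<gamma>(1) that in blast)
      have "finite (\<rho> ` {i. f i \<noteq> e})"
        using \<gamma>(2) \<psi>f unfolding supp[of f, OF fL, symmetric] by (simp cong: conj_cong)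
      then have "finite {i. f i \<noteq> e}"
        by (rule finite_imageD) (use \<rho> in \<open>auto simp: bij_betw_def intro: inj_on_subset\<close>)
      then have "(f, \<nu> h) \<in> configs" using fL by (simp add: configs_def)
      moreover have "(\<lambda>h\<in>carrier H. \<psi> (f (\<nu> h))) = \<gamma>"
      proof
        fix x show "(\<lambda>h\<in>carrier H. \<psi> (f (\<nu> h))) x = \<gamma> x"
          using \<gamma>(1) \<psi>f by (cases "x \<in> carrier H") (auto simp: PiE_def extensional_def)
      qed
      then have "w = \<Phi> (f, \<nu> h)" using \<rho>\<nu>[OF \<gamma>(3)] by (simp add: w \<Phi>_def)
      ultimately show "w \<in> \<Phi> ` configs" by blast
    qed (use \<Phi>W in blast)
  qed
  define \<psi>' where "\<psi>' = \<Phi> \<circ> inv_into configs code"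
  have \<psi>'_code: "\<psi>' (code c) = \<Phi> c" if "c \<in> configs" for c
    using inj_on_code that by (simp add: \<psi>'_def)
  have \<psi>'_bij: "bij_betw \<psi>' (code ` configs) (carrier W)"
    unfolding \<psi>'_def
    by (rule bij_betw_trans[OF bij_betw_inv_into[OF inj_on_imp_bij_betw[OF inj_on_code]] \<Phi>_bij])
  \<comment> \<open>If right multiplication by \<open>s\<close> is given on configurations by a map \<open>\<mu>\<close>, then its relation on codes is
    the graph of \<open>\<mu>\<close>.\<close>
  have translate: "{(u, v). u \<in> code ` configs \<and> v \<in> code ` configs \<and> \<psi>' u \<otimes>\<^bsub>W\<^esub> s = \<psi>' v} =
      {(code c, code (\<mu> c)) | c. c \<in> configs}"
    if \<mu>: "\<And>c. c \<in> configs \<Longrightarrow> \<mu> c \<in> configs \<and> \<Phi> c \<otimes>\<^bsub>W\<^esub> s = \<Phi> (\<mu> c)" for s \<mu>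
  proof -
    have iff: "\<Phi> c \<otimes>\<^bsub>W\<^esub> s = \<Phi> c' \<longleftrightarrow> c' = \<mu> c" if "c \<in> configs" "c' \<in> configs" for c c'
      using \<mu>[OF that(1)] that \<Phi>_bij by (auto simp: bij_betw_def dest: inj_onD)
    show ?thesis
    proof (intro equalityI subrelI)
      fix u v assume "(u, v) \<in> {(u, v). u \<in> code ` configs \<and> v \<in> code ` configs \<and> \<psi>' u \<otimes>\<^bsub>W\<^esub> s = \<psi>' v}"
      then obtain c c' where "u = code c" "v = code c'" "c \<in> configs" "c' \<in> configs"
        "\<psi>' u \<otimes>\<^bsub>W\<^esub> s = \<psi>' v" by blast
      then show "(u, v) \<in> {(code c, code (\<mu> c)) | c. c \<in> configs}"
        using iff[of c c'] by (intro CollectI exI[of _ c]) (simp add: \<psi>'_code)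
    next
      fix u v assume "(u, v) \<in> {(code c, code (\<mu> c)) | c. c \<in> configs}"
      then obtain c where "u = code c" "v = code (\<mu> c)" "c \<in> configs" by blast
      then show "(u, v) \<in> {(u, v). u \<in> code ` configs \<and> v \<in> code ` configs \<and> \<psi>' u \<otimes>\<^bsub>W\<^esub> s = \<psi>' v}"
        using \<mu>[of c] by (simp add: \<psi>'_code)
    qed
  qed

  have lamps_regular: "regular_relation tape_alphabet
      {(u, v). u \<in> code ` configs \<and> v \<in> code ` configs \<and> \<psi>' u \<otimes>\<^bsub>W\<^esub> lamp a = \<psi>' v}" if a: "a \<in> S" for a
  proof -
    define R where "R = {(u, v). u \<in> L \<and> v \<in> L \<and> \<psi> u \<otimes>\<^bsub>G\<^esub> a = \<psi> v}"
    obtain c where R: "sync_regular \<Lambda> R" "lag_bounded c R"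
      using cayley_automatic_relation[OF G struct a] unfolding R_def by blast
    have aG: "a \<in> carrier G" using a S(2) by blast
    define \<mu> where "\<mu> = (\<lambda>(f :: nat \<Rightarrow> nat list, k). (f(k := \<iota> (\<psi> (f k) \<otimes>\<^bsub>G\<^esub> a)), k))"
    have \<mu>: "\<mu> c \<in> configs \<and> \<Phi> c \<otimes>\<^bsub>W\<^esub> lamp a = \<Phi> (\<mu> c)" if "c \<in> configs" for c
    proof -
      obtain f k where c: "c = (f, k)" by (cases c)
      have f: "\<And>i. f i \<in> L" "finite {i. f i \<noteq> e}" using that by (simp_all add: c configs_def)
      have prod: "\<psi> (f k) \<otimes>\<^bsub>G\<^esub> a \<in> carrier G" using f(1) \<psi>G aG by simp
      have "finite {i. (f(k := v)) i \<noteq> e}" for v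
        by (rule finite_subset[of _ "insert k {i. f i \<noteq> e}"]) (use f(2) in auto)
      then have "\<mu> c \<in> configs" using f(1) \<iota>(1)[OF prod] by (simp add: c \<mu>_def configs_def)
      moreover have "(\<lambda>h\<in>carrier H. \<psi> (f (\<nu> h)))(\<rho> k := \<psi> (f k) \<otimes>\<^bsub>G\<^esub> a) =
          (\<lambda>h\<in>carrier H. \<psi> ((f(k := \<iota> (\<psi> (f k) \<otimes>\<^bsub>G\<^esub> a))) (\<nu> h)))"
        using \<iota>(2)[OF prod] \<rho>H \<nu> \<rho>\<nu> by (auto simp: fun_eq_iff restrict_def)
      then have "\<Phi> c \<otimes>\<^bsub>W\<^esub> lamp a = \<Phi> (\<mu> c)"
        using \<Phi>W[OF that] mult_lamp[OF _ aG] by (simp add: c \<Phi>_def \<mu>_def \<rho>H \<nu>)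
      ultimately show ?thesis ..
    qed
    have codes: "{(code (f, k), code (f(k := v), k)) | f k v. (f, k) \<in> configs \<and> (f k, v) \<in> R} =
        {(code c, code (\<mu> c)) | c. c \<in> configs}"
    proof -
      have iff: "(f k, v) \<in> R \<longleftrightarrow> v = \<iota> (\<psi> (f k) \<otimes>\<^bsub>G\<^esub> a)" if "(f, k) \<in> configs" for f k v
      proof -
        have fk: "f k \<in> L" using that by (simp add: configs_def)
        then have prod: "\<psi> (f k) \<otimes>\<^bsub>G\<^esub> a \<in> carrier G" using \<psi>G aG by simp
        have "(f k, v) \<in> R \<longleftrightarrow> v \<in> L \<and> \<psi> (f k) \<otimes>\<^bsub>G\<^esub> a = \<psi> v"
          unfolding R_def using fk by simp
        also have "\<dots> \<longleftrightarrow> v = \<iota> (\<psi> (f k) \<otimes>\<^bsub>G\<^esub> a)"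
          using \<psi>_inj[OF \<iota>(1)[OF prod], of v] \<iota>[OF prod] by metis
        finally show ?thesis .
      qed
      show ?thesis
      proof (intro equalityI subrelI)
        fix x y assume "(x, y) \<in> {(code (f, k), code (f(k := v), k)) | f k v.
          (f, k) \<in> configs \<and> (f k, v) \<in> R}"
        then obtain f k v where "x = code (f, k)" "y = code (f(k := v), k)" "(f, k) \<in> configs" "(f k, v) \<in> R"
          by blast
        then show "(x, y) \<in> {(code c, code (\<mu> c)) | c. c \<in> configs}"
          using iff[of f k v] by (intro CollectI exI[of _ "(f, k)"]) (simp add: \<mu>_def)
      next
        fix x y assume "(x, y) \<in> {(code c, code (\<mu> c)) | c. c \<in> configs}"
        then obtain f k where "x = code (f, k)" "y = code (\<mu> (f, k))" "(f, k) \<in> configs"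
          by auto
        then show "(x, y) \<in> {(code (f, k), code (f(k := v), k)) | f k v.
          (f, k) \<in> configs \<and> (f k, v) \<in> R}"
          using iff[of f k] by (intro CollectI exI[of _ f] exI[of _ k] exI) (simp add: \<mu>_def)
      qed
    qed
    have "R \<subseteq> L \<times> L" by (auto simp: R_def)
    then have "regular_relation tape_alphabet {(code c, code (\<mu> c)) | c. c \<in> configs}"
      using relight_codes_regular[OF R(1) _ R(2)] unfolding codes by blast
    moreover have "{(u, v). u \<in> code ` configs \<and> v \<in> code ` configs \<and> \<psi>' u \<otimes>\<^bsub>W\<^esub> lamp a = \<psi>' v} =
        {(code c, code (\<mu> c)) | c. c \<in> configs}"
      by (rule translate) (rule \<mu>)
    ultimately show ?thesis by simp
  qed
  have walks_regular: "regular_relation tape_alphabet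
      {(u, v). u \<in> code ` configs \<and> v \<in> code ` configs \<and> \<psi>' u \<otimes>\<^bsub>W\<^esub> walk t = \<psi>' v}" if t: "t \<in> T" for t
  proof -
    have tH: "t \<in> carrier H" using t T(2) by blast
    obtain \<sigma> b where \<sigma>: "\<And>k. \<rho> k \<otimes>\<^bsub>H\<^esub> t = \<rho> (\<sigma> k)" and per: "\<And>k. k \<ge> b \<Longrightarrow> \<sigma> (k + D) = \<sigma> k + D"
      using steps[OF tH] by blast
    define \<mu> where "\<mu> = (\<lambda>(f :: nat \<Rightarrow> nat list, k). (f, \<sigma> k))"
    have \<mu>: "\<mu> c \<in> configs \<and> \<Phi> c \<otimes>\<^bsub>W\<^esub> walk t = \<Phi> (\<mu> c)" if "c \<in> configs" for c
    proof -
      obtain f k where c: "c = (f, k)" by (cases c)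
      show ?thesis
        using that \<Phi>W[OF that] mult_walk[OF _ tH] by (simp add: c \<mu>_def configs_def \<Phi>_def \<sigma>)
    qed
    have "{(code (f, k), code (f, \<sigma> k)) | f k. (f, k) \<in> configs} = {(code c, code (\<mu> c)) | c. c \<in> configs}"
      by (simp add: \<mu>_def)
    then have "regular_relation tape_alphabet {(code c, code (\<mu> c)) | c. c \<in> configs}"
      using move_codes_regular[of b \<sigma> D, OF per D] by simp
    moreover have "{(u, v). u \<in> code ` configs \<and> v \<in> code ` configs \<and> \<psi>' u \<otimes>\<^bsub>W\<^esub> walk t = \<psi>' v} =
        {(code c, code (\<mu> c)) | c. c \<in> configs}"
      by (rule translate) (rule \<mu>)
    ultimately show ?thesis by simp
  qed
  have "m_inv W ` lamp ` S = lamp ` m_inv G ` S"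
    using S(2) by (force simp: image_iff)
  moreover have "m_inv W ` walk ` T = walk ` m_inv H ` T"
    using T(2) by (force simp: image_iff)
  ultimately have "m_inv W ` (lamp ` S \<union> walk ` T) = lamp ` S \<union> walk ` T"
    by (simp only: image_Un S(3) T(3))
  moreover have "lamp ` S \<union> walk ` T \<subseteq> carrier W"
    using S(2) T(2) lamp_in_W walk_in_W by blast
  moreover have "generate W (lamp ` S \<union> walk ` T) = carrier W"
    by (rule generate_W[OF S(2,4) T(2,4)])
  ultimately have "cayley_automatic_structure W (lamp ` S \<union> walk ` T) tape_alphabet (code ` configs) \<psi>'"
    unfolding cayley_automatic_structure_def
  proof (intro conjI ballI)
    fix s assume "s \<in> lamp ` S \<union> walk ` T"
    then show "regular_relation tape_alphabet
        {(u, v). u \<in> code ` configs \<and> v \<in> code ` configs \<and> \<psi>' u \<otimes>\<^bsub>W\<^esub> s = \<psi>' v}"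
      using lamps_regular walks_regular by (elim UnE imageE) simp_all
  qed (use S(1) T(1) codes_regular \<psi>'_bij in simp_all)
  then show ?thesis using W_group unfolding cayley_automatic_def by blast
qed

end
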